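(* As $n\to\infty$, $\boldsymbol\theta_n\to\theta_*$ almost surely.
   Context: Setting. $\Delta=\Delta^o\cup\{0\}$ is a finite set, $\Delta^o=\{1,\dots,d\}$ nonempty, $0\notin\Delta^o$. $P=(P_{x,y})_{x,y\in\Delta}$ is the transition matrix of a Markov chain $\{Y_n\}$ on $\Delta$ with $0$ absorbing ($P_{0,0}=1$); $\Delta^o$ is an irreducible class of the chain and $P_{x,0}>0$ for some $x\in\Delta^o$. $\mathcal{P}(\Delta^o)$ is identified with the simplex $\{x\in\mathbb{R}_+^d:\sum_i x_i=1\}$. $\theta_*$ is the unique quasi-stationary distribution: the unique $\mu\in\mathcal{P}(\Delta^o)$ with $\mathbf{P}_\mu(Y_n=x\mid Y_n\in\Delta^o)=\mu(x)$ for all $x\in\Delta^o$, $n\in\mathbb{N}$. For $\nu\in\mathcal{P}(\Delta^o)$, $K[\nu]_{x,y}=P_{x,y}+P_{x,0}\,\nu(y)$, $x,y\in\Delta^o$. Step sizes: $\gamma_*>0$, $N_*=\lfloor\gamma_*\rfloor+1$, $\gamma_{k+1}=\gamma_*/(k+N_* )$ for $k\in\mathbb{N}_0$. Algorithm II. Fix $\zeta\in(0,1)$; the $n$-th particle is added at time $b(n)$, where $b(1)=0$ and $b(n)=\lfloor n^{1/\zeta}\rfloor$ for $n\ge2$, and $a(k)=\max\{n\ge1:b(n)\le k\}$, $k\in\mathbb N_0$, is the number of particles at time $k$ (so $a(0)=a(1)=1$, $a$ is non-decreasing with increments at most $1$, $a(n)\sim n^\zeta$). Fix $x_0\in\Delta^o$.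 On a probability space $(\Omega,\mathcal F,\mathbf P)$ there are $\Delta^o$-valued random variables $\boldsymbol X^i_n$ ($1\le i\le a(n+1)$, $n\in\mathbb N_0$), random variables $\iota_n\in\{1,\dots,a(n)\}$, random probability measures $\boldsymbol\theta_n\in\mathcal P(\Delta^o)$ and $\sigma$-fields $\boldsymbol{\mathcal F}_n$ such that $\boldsymbol X^1_0=x_0$, $\iota_0=\iota_1=1$, $\boldsymbol{\mathcal F}_0=\{\emptyset,\Omega\}$, $\boldsymbol\theta_0=\delta_{x_0}$, and for $n\in\mathbb N_0$: (1) if $a(n+2)=a(n+1)$, then on $\{\boldsymbol X^i_n=x_i,\,1\le i\le a(n+1)\}$, $\mathbf P(\boldsymbol X^i_{n+1}=y_i,\,1\le i\le a(n+2)\mid\boldsymbol{\mathcal F}_n)=\prod_{i=1}^{a(n+1)}K[\boldsymbol\theta_n]_{x_i,y_i}$; if $a(n+2)=a(n+1)+1$, then on $\{\boldsymbol X^i_n=x_i,\,1\le i\le a(n+1),\ \iota_{n+1}=\ell\}$ this conditional probability equals $\big(\prod_{i=1}^{a(n+1)}K[\boldsymbol\theta_n]_{x_i,y_i}\big)K[\boldsymbol\theta_n]_{x_\ell,y_{a(n+2)}}$; (2) with $\boldsymbol{\mathcal G}_{n+1}=\boldsymbol{\mathcal F}_n\vee\sigma(\boldsymbol X^1_{n+1},\dots,\boldsymbol X^{a(n+2)}_{n+1})$ and $\boldsymbol{\mathcal H}_{n+1}$ an arbitrary $\sigma$-field independent of $\boldsymbol{\mathcal G}_{n+1}$, $\iota_{n+2}$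 is an arbitrary $\boldsymbol{\mathcal G}_{n+1}\vee\boldsymbol{\mathcal H}_{n+1}$-measurable random variable with values in $\{1,\dots,a(n+2)\}$; (3) $\boldsymbol{\mathcal F}_{n+1}=\boldsymbol{\mathcal G}_{n+1}\vee\sigma(\iota_{n+2})$; (4) $\boldsymbol\theta_{n+1}=(1-\gamma_{n+1})\boldsymbol\theta_n+\gamma_{n+1}\frac1{a(n+1)}\sum_{i=1}^{a(n+1)}\delta_{\boldsymbol X^i_{n+1}}$. *)

theory Defs
  imports "HOL-Probability.Probability"
begin

text \<open>
  The set \<open>\<Delta>\<^sup>o\<close> of non-absorbing states is a finite type \<open>'s\<close> (so \<open>d = CARD('s) \<ge> 1\<close>), and
  \<open>\<Delta> = \<Delta>\<^sup>o \<union> {0}\<close> is \<open>'s option\<close>, with \<open>None\<close> playing the role of the absorbing state \<open>0\<close>.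
\<close>

definition prob_vectors :: "(real ^ 's::finite) set" where
  "prob_vectors = {\<mu>. (\<forall>x. 0 \<le> \<mu> $ x) \<and> (\<Sum>x\<in>UNIV. \<mu> $ x) = 1}"

text \<open>The Dirac measure at \<open>x\<close> is the vector \<open>axis x 1\<close>.\<close>

abbreviation dirac :: "'s \<Rightarrow> real ^ 's::finite" where
  "dirac x \<equiv> axis x 1"

definition extend_law :: "real ^ 's::finite \<Rightarrow> real ^ ('s option)" where
  "extend_law \<mu> = (\<chi> z. case z of None \<Rightarrow> 0 | Some x \<Rightarrow> \<mu> $ x)"

definition stochastic_matrix :: "real ^ 'a::finite ^ 'a \<Rightarrow> bool" where
  "stochastic_matrix P \<longleftrightarrow> (\<forall>x y. 0 \<le> P $ x $ y) \<and> (\<forall>x. (\<Sum>y\<in>UNIV. P $ x $ y) = 1)"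

text \<open>The power of matrices has to be spelled out: \<open>P ^ n\<close> would be the componentwise power.\<close>

definition n_step :: "real ^ 'a::finite ^ 'a \<Rightarrow> nat \<Rightarrow> real ^ 'a ^ 'a" where
  "n_step P n = ((**) P ^^ n) (mat 1)"

definition markov_chain ::
  "'v measure \<Rightarrow> (nat \<Rightarrow> 'v \<Rightarrow> 'a::finite) \<Rightarrow> real ^ 'a ^ 'a \<Rightarrow> real ^ 'a \<Rightarrow> bool" where
  "markov_chain M Y P init \<longleftrightarrow>
     prob_space M \<and>
     (\<forall>n. Y n \<in> measurable M (count_space UNIV)) \<and>
     (\<forall>z. \<P>(w in M. Y 0 w = z) = init $ z) \<and>
     (\<forall>n (z :: nat \<Rightarrow> 'a).
        \<P>(w in M. \<forall>k\<le>n. Y k w = z k) > 0 \<longrightarrow>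
        \<P>(w in M. Y (Suc n) w = z (Suc n) \<bar> \<forall>k\<le>n. Y k w = z k) = P $ z n $ z (Suc n))"

text \<open>\<open>PP \<mu>\<close> is the law \<open>\<^bold>P\<^sub>\<mu>\<close> under which \<open>Y\<close> starts from the initial distribution \<open>\<mu>\<close>.\<close>

locale absorbed_chain =
  fixes P :: "real ^ ('s::finite option) ^ ('s option)"
    and PP :: "real ^ 's \<Rightarrow> 'v measure"
    and Y :: "nat \<Rightarrow> 'v \<Rightarrow> 's option"
  assumes stochastic: "stochastic_matrix P"
    and absorbing: "P $ None $ None = 1"
    and irreducible_class: "\<And>x y. \<exists>n\<ge>1. n_step P n $ Some x $ Some y > 0"
    and exit: "\<exists>x. P $ Some x $ None > 0"
    and chain: "\<And>\<mu>. \<mu> \<in> prob_vectors \<Longrightarrow> markov_chain (PP \<mu>) Y P (extend_law \<mu>)"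

definition quasi_stationary ::
  "(real ^ 's::finite \<Rightarrow> 'v measure) \<Rightarrow> (nat \<Rightarrow> 'v \<Rightarrow> 's option) \<Rightarrow> real ^ 's \<Rightarrow> bool" where
  "quasi_stationary PP Y \<mu> \<longleftrightarrow>
     \<mu> \<in> prob_vectors \<and>
     (\<forall>n\<ge>1. \<forall>x. \<P>(w in PP \<mu>. Y n w = Some x \<bar> Y n w \<noteq> None) = \<mu> $ x)"

definition K :: "real ^ ('s::finite option) ^ ('s option) \<Rightarrow> real ^ 's \<Rightarrow> real ^ 's ^ 's" where
  "K P \<nu> = (\<chi> x y. P $ Some x $ Some y + P $ Some x $ None * \<nu> $ y)"

definition N_star :: "real \<Rightarrow> nat" where
  "N_star gs = nat \<lfloor>gs\<rfloor> + 1"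

text \<open>The step sizes are indexed from 1; the value at 0 is not used.\<close>

primrec step_size :: "real \<Rightarrow> nat \<Rightarrow> real" where
  "step_size gs 0 = 0"
| "step_size gs (Suc k) = gs / real (k + N_star gs)"

definition add_time :: "real \<Rightarrow> nat \<Rightarrow> nat" where
  "add_time \<zeta> n = (if n = 1 then 0 else nat \<lfloor>real n powr (1 / \<zeta>)\<rfloor>)"

text \<open>For \<open>0 < \<zeta> < 1\<close> the set below is finite and contains 1.\<close>

definition num_particles :: "real \<Rightarrow> nat \<Rightarrow> nat" where
  "num_particles \<zeta> k = Max {n. n \<ge> 1 \<and> add_time \<zeta> n \<le> k}"

text \<open>
  Sub-\<open>\<sigma>\<close>-fields of \<open>M\<close> are represented by measures of which only the space and the measurable
  sets matter.
\<close>

definition join_algebra :: "'w measure \<Rightarrow> 'w measure \<Rightarrow> 'w measure" where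
  "join_algebra A B = sigma (space A) (sets A \<union> sets B)"

definition gen_algebra :: "'w set \<Rightarrow> 'i set \<Rightarrow> ('i \<Rightarrow> 'w \<Rightarrow> 'b) \<Rightarrow> 'w measure" where
  "gen_algebra \<Omega> I X = sigma \<Omega> (\<Union>i\<in>I. sets (vimage_algebra \<Omega> (X i) (count_space UNIV)))"

text \<open>
  \<open>X n i\<close> is the position of particle \<open>i\<close> at time \<open>n\<close>. It is constrained only for
  \<open>1 \<le> i \<le> a (n + 1)\<close>; likewise \<open>G\<close> and \<open>H\<close> are constrained only at positive times.
\<close>

locale algorithm_II = prob_space M
  for M :: "'w measure" +
  fixes P :: "real ^ ('s::finite option) ^ ('s option)"
    and gs \<zeta> :: real
    and x0 :: 's
    and X :: "nat \<Rightarrow> nat \<Rightarrow> 'w \<Rightarrow> 's"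
    and \<iota> :: "nat \<Rightarrow> 'w \<Rightarrow> nat"
    and \<theta> :: "nat \<Rightarrow> 'w \<Rightarrow> real ^ 's"
    and F G H :: "nat \<Rightarrow> 'w measure"
    and a :: "nat \<Rightarrow> nat"
  defines "a \<equiv> num_particles \<zeta>"
  assumes X_meas: "\<And>n i. i \<in> {1..a (n + 1)} \<Longrightarrow> X n i \<in> measurable M (count_space UNIV)"
    and iota_meas: "\<And>n. \<iota> n \<in> measurable M (count_space UNIV)"
    and iota_range: "\<And>n w. w \<in> space M \<Longrightarrow> \<iota> n w \<in> {1..a n}"
    and theta_meas: "\<And>n. \<theta> n \<in> borel_measurable M"
    and theta_range: "\<And>n w. w \<in> space M \<Longrightarrow> \<theta> n w \<in> prob_vectors"
    and F_sub: "\<And>n. subalgebra M (F n)"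
    and X_0: "\<And>w. w \<in> space M \<Longrightarrow> X 0 1 w = x0"
    and iota_0: "\<And>w. w \<in> space M \<Longrightarrow> \<iota> 0 w = 1"
    and iota_1: "\<And>w. w \<in> space M \<Longrightarrow> \<iota> 1 w = 1"
    and F_0: "sets (F 0) = {{}, space M}"
    and theta_0: "\<And>w. w \<in> space M \<Longrightarrow> \<theta> 0 w = dirac x0"
    and step_same: "\<And>n x y. a (n + 2) = a (n + 1) \<Longrightarrow>
      AE w in M. (\<forall>i\<in>{1..a (n + 1)}. X n i w = x i) \<longrightarrow>
        real_cond_exp M (F n)
          (indicator {v \<in> space M. \<forall>i\<in>{1..a (n + 2)}. X (n + 1) i v = y i}) w
        = (\<Prod>i = 1..a (n + 1). K P (\<theta> n w) $ x i $ y i)"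
    and step_add: "\<And>n x y l. a (n + 2) = a (n + 1) + 1 \<Longrightarrow> l \<in> {1..a (n + 1)} \<Longrightarrow>
      AE w in M. (\<forall>i\<in>{1..a (n + 1)}. X n i w = x i) \<and> \<iota> (n + 1) w = l \<longrightarrow>
        real_cond_exp M (F n)
          (indicator {v \<in> space M. \<forall>i\<in>{1..a (n + 2)}. X (n + 1) i v = y i}) w
        = (\<Prod>i = 1..a (n + 1). K P (\<theta> n w) $ x i $ y i)
          * K P (\<theta> n w) $ x l $ y (a (n + 2))"
    and G_sub: "\<And>n. subalgebra M (G (n + 1))"
    and G_step: "\<And>n. sets (G (n + 1)) =
      sets (join_algebra (F n) (gen_algebra (space M) {1..a (n + 2)} (X (n + 1))))"
    and H_sub: "\<And>n. subalgebra M (H (n + 1))"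
    and H_indep: "\<And>n. indep_set (sets (H (n + 1))) (sets (G (n + 1)))"
    and iota_step: "\<And>n. \<iota> (n + 2) \<in>
      measurable (join_algebra (G (n + 1)) (H (n + 1))) (count_space UNIV)"
    and F_step: "\<And>n. sets (F (n + 1)) =
      sets (join_algebra (G (n + 1)) (vimage_algebra (space M) (\<iota> (n + 2)) (count_space UNIV)))"
    and theta_step: "\<And>n w. w \<in> space M \<Longrightarrow>
      \<theta> (n + 1) w = (1 - step_size gs (n + 1)) *\<^sub>R \<theta> n w
        + (step_size gs (n + 1) * (1 / real (a (n + 1))))
            *\<^sub>R (\<Sum>i = 1..a (n + 1). dirac (X (n + 1) i w))"

end

theory Submission
  imports Defs
begin

text \<open>
  Write \<open>Q\<close> for the transition matrix of the killed chain and \<open>T = (I - Q)\<^sup>-\<^sup>1\<close> for its Green operator,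
  both acting on row vectors. Let \<open>m n\<close> be the empirical measure of the particles at time \<open>n\<close> and
  \<open>\<rho> n\<close> the mass that it assigns to the exit probabilities. Up to a martingale difference and the
  effect of an added particle, \<open>m (n + 1) = m n Q + \<rho> n \<theta> n\<close>. Applying \<open>T\<close> gives
  \<open>m (n + 1) = \<rho> n \<theta> n T\<close> plus a noise whose series weighted by the step sizes converges almost surely
  (by Abel summation for the increments of \<open>m\<close>). Hence \<open>\<theta>\<close> follows, up to this noise, the linear
  recursion \<open>\<theta> (n + 1) = (1 - \<gamma>) \<theta> n + \<gamma> \<rho> n \<theta> n T\<close>, so no ordinary differential equation is needed:
  by the Perron-Frobenius theory of the strictly positive operator \<open>T\<close>, whose left Perron eigenvector is
  \<open>\<theta>\<^sub>*\<close>, the component of \<open>\<theta> n\<close> transversal to \<open>\<theta>\<^sub>*\<close> vanishes relative to the one along it.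
\<close>

section \<open>The Green operator of the killed chain\<close>

text \<open>The kernel \<open>K P \<nu>\<close> is Q plus a matrix of rank one, the exit
  probabilities times \<open>\<nu>\<close>. Hence one operator T, independent of
  \<open>\<theta> n\<close>, serves at all times, in place of a Poisson equation whose solution
  moves with \<open>\<theta> n\<close>. As T is the sum of all powers of Q, irreducibility makes it
  strictly positive even when Q is periodic.

  The obstacle is that contraction acts at the rate \<open>\<gamma> \<rho> n\<close>, and no lower
  bound holds for \<open>\<rho> n\<close> at a single time: all particles may sit where exit is
  impossible. Comparing total masses in the solved equation repairs this. It gives
  \<open>1 - z n \<le> C * \<rho> n\<close>, where \<open>z n\<close> is the mass of the noise;
  since the series of \<open>\<gamma> z\<close> converges and that of \<open>\<gamma>\<close>
  diverges, the series of \<open>\<gamma> \<rho>\<close> diverges as well, for every value of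
  \<open>gs > 0\<close>.

  The component along \<open>\<theta>\<^sub>*\<close> may grow or shrink from step to step. It
  matters only that it stays away from 0, so that the ratio of the two components is meaningful; its
  limit is read off at the end from the total mass.\<close>

definition killed_step :: "real ^ ('s::finite option) ^ ('s option) \<Rightarrow> real ^ 's \<Rightarrow> real ^ 's" where
  "killed_step P \<mu> = (\<chi> y. \<Sum>x\<in>UNIV. \<mu> $ x * P $ Some x $ Some y)"

text \<open>For nonnegative \<open>x\<close> this is \<open>v \<bullet> x\<close>, so a nonnegative
  matrix with right eigenvector \<open>v\<close> scales it on such \<open>x\<close> by exactly the
  eigenvalue.\<close>

definition weighted_norm :: "real ^ 's::finite \<Rightarrow> real ^ 's \<Rightarrow> real" where
  "weighted_norm v x = (\<Sum>i\<in>UNIV. v $ i * \<bar>x $ i\<bar>)"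

lemma linear_killed_step: "linear (killed_step P)"
  by (rule linearI)
    (simp_all add: killed_step_def vec_eq_iff algebra_simps sum.distrib sum_distrib_left)

lemma sum_option_UNIV:
  fixes f :: "'s::finite option \<Rightarrow> real"
  shows "(\<Sum>z\<in>UNIV. f z) = f None + (\<Sum>x\<in>UNIV. f (Some x))"
  by (simp add: UNIV_option_conv sum.reindex)

lemma stochastic_matrix_killed_row:
  fixes P :: "real ^ ('s::finite option) ^ ('s option)"
  assumes "stochastic_matrix P"
  shows "(\<Sum>y\<in>UNIV. P $ Some x $ Some y) = 1 - P $ Some x $ None"
proof -
  have "(\<Sum>z\<in>UNIV. P $ Some x $ z) = 1"
    using assms by (simp add: stochastic_matrix_def)
  then show ?thesis
    by (simp add: sum_option_UNIV)
qed

lemma sum_killed_step: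
  assumes "stochastic_matrix P"
  shows "(\<Sum>y\<in>UNIV. killed_step P \<mu> $ y) = (\<Sum>x\<in>UNIV. \<mu> $ x * (1 - P $ Some x $ None))"
proof -
  have "(\<Sum>y\<in>UNIV. killed_step P \<mu> $ y) = (\<Sum>x\<in>UNIV. \<Sum>y\<in>UNIV. \<mu> $ x * P $ Some x $ Some y)"
    by (simp add: killed_step_def) (rule sum.swap)
  then show ?thesis
    by (simp add: stochastic_matrix_killed_row[OF assms] flip: sum_distrib_left)
qed

context absorbed_chain
begin

lemma P_nonneg: "0 \<le> P $ x $ y"
  using stochastic by (simp add: stochastic_matrix_def)

lemma P_None_Some: "P $ None $ Some y = 0"
proof -
  have "(\<Sum>z\<in>UNIV. P $ None $ z) = 1"
    using stochastic by (simp add: stochastic_matrix_def)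
  then have "(\<Sum>x\<in>UNIV. P $ None $ Some x) = 0"
    by (simp add: sum_option_UNIV absorbing)
  then show ?thesis
    by (simp add: sum_nonneg_eq_0_iff P_nonneg)
qed

text \<open>Irreducibility in one-step form: the supports and zero sets met below are closed under
  transitions of positive probability, so a single point in them fills the state space.\<close>

lemma closed_set_eq_UNIV:
  assumes ne: "x0 \<in> S" and cl: "\<And>x y. x \<in> S \<Longrightarrow> P $ Some x $ Some y > 0 \<Longrightarrow> y \<in> S"
  shows "S = UNIV"
proof -
  \<comment> \<open>A path may leave \<open>S\<close> only by exiting; \<open>None\<close> is
    absorbing, so adding it keeps the set closed under all of \<open>P\<close>.\<close>
  let ?S = "insert None (Some ` S)"
  have nn: "n_step P n $ x $ z \<ge> 0" for n x z
  proof (induction n arbitrary: x)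
    case 0
    then show ?case by (simp add: n_step_def mat_def)
  next
    case (Suc n)
    then show ?case
      by (simp add: n_step_def matrix_matrix_mult_def sum_nonneg P_nonneg)
  qed
  have *: "x \<in> ?S \<Longrightarrow> n_step P n $ x $ z > 0 \<Longrightarrow> z \<in> ?S" for n x z
  proof (induction n arbitrary: x)
    case 0
    then show ?case by (simp add: n_step_def mat_def split: if_splits)
  next
    case (Suc n)
    have "(\<Sum>u\<in>UNIV. P $ x $ u * n_step P n $ u $ z) > 0"
      using Suc.prems(2) by (simp add: n_step_def matrix_matrix_mult_def)
    then obtain u where "P $ x $ u * n_step P n $ u $ z > 0"
      by (meson not_less sum_nonpos)
    then have u: "P $ x $ u > 0" "n_step P n $ u $ z > 0"
      using P_nonneg[of x u] nn[of n u z] by (auto simp: zero_less_mult_iff)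
    have "u \<in> ?S"
    proof (cases u)
      case (Some y)
      with u(1) have "x \<noteq> None"
        by (metis P_None_Some less_irrefl)
      with Suc.prems(1) obtain x' where "x = Some x'" "x' \<in> S"
        by auto
      with u(1) Some cl show ?thesis
        by auto
    qed simp
    then show ?case
      using Suc.IH u(2) by blast
  qed
  have "y \<in> S" for y
  proof -
    obtain n where "n_step P n $ Some x0 $ Some y > 0"
      using irreducible_class by blast
    with * ne have "Some y \<in> ?S"
      by blast
    then show ?thesis
      by auto
  qed
  then show ?thesis
    by auto
qed

lemma law_Y1:
  assumes \<mu>: "\<mu> \<in> prob_vectors"
  shows "measure (PP \<mu>) {w \<in> space (PP \<mu>). Y 1 w = Some y} = killed_step P \<mu> $ y"
proof -
  from chain[OF \<mu>] have ps: "prob_space (PP \<mu>)"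
    and Ym: "\<And>n. Y n \<in> measurable (PP \<mu>) (count_space UNIV)"
    and init: "\<And>z. \<P>(w in PP \<mu>. Y 0 w = z) = extend_law \<mu> $ z"
    and step: "\<And>n z. \<P>(w in PP \<mu>. \<forall>k\<le>n. Y k w = z k) > 0 \<Longrightarrow>
        \<P>(w in PP \<mu>. Y (Suc n) w = z (Suc n) \<bar> \<forall>k\<le>n. Y k w = z k) = P $ z n $ z (Suc n)"
    by (auto simp: markov_chain_def)
  interpret p: prob_space "PP \<mu>" by fact
  note Ym[measurable]
  have joint: "\<P>(w in PP \<mu>. Y 1 w = z \<and> Y 0 w = x) = extend_law \<mu> $ x * P $ x $ z" for x z
  proof (cases "extend_law \<mu> $ x = 0")
    case True
    have "\<P>(w in PP \<mu>. Y 1 w = z \<and> Y 0 w = x) \<le> \<P>(w in PP \<mu>. Y 0 w = x)"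
      by (rule p.finite_measure_mono) auto
    then show ?thesis
      using True init[of x] by (simp add: measure_le_0_iff)
  next
    case False
    let ?z = "\<lambda>k::nat. if k = 0 then x else z"
    have eq: "(\<forall>k\<le>0. Y k w = ?z k) \<longleftrightarrow> Y 0 w = x" for w
      by auto
    have pos: "\<P>(w in PP \<mu>. Y 0 w = x) > 0"
      using False init[of x] measure_nonneg[of "PP \<mu>" "{w \<in> space (PP \<mu>). Y 0 w = x}"] by linarith
    have "\<P>(w in PP \<mu>. Y (Suc 0) w = z \<bar> Y 0 w = x) = P $ x $ z"
      using step[of 0 ?z] pos by (simp add: eq)
    then show ?thesis
      using pos init[of x] by (simp add: cond_prob_def field_simps)
  qed
  have "measure (PP \<mu>) {w \<in> space (PP \<mu>). Y 1 w = Some y}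
      = measure (PP \<mu>) (\<Union>x\<in>UNIV. {w \<in> space (PP \<mu>). Y 1 w = Some y \<and> Y 0 w = x})"
    by (rule arg_cong[where f = "measure _"]) auto
  also have "\<dots> = (\<Sum>x\<in>UNIV. measure (PP \<mu>) {w \<in> space (PP \<mu>). Y 1 w = Some y \<and> Y 0 w = x})"
    by (rule p.finite_measure_finite_Union) (auto simp: disjoint_family_on_def)
  also have "\<dots> = killed_step P \<mu> $ y"
    by (simp add: joint sum_option_UNIV extend_law_def killed_step_def del: One_nat_def)
  finally show ?thesis .
qed

text \<open>At time 1 quasi-stationarity says that \<open>killed_step P \<mu>\<close> divided by the
  survival probability \<open>r\<close> is \<open>\<mu>\<close>. Irreducibility spreads positivity
  to all states, and the mass lost at a state with positive exit probability gives
  \<open>r < 1\<close>.\<close>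

lemma quasi_stationary_eigenvector:
  assumes qs: "quasi_stationary PP Y \<mu>"
  obtains r where "0 < r" "r < 1" "killed_step P \<mu> = r *\<^sub>R \<mu>" "\<And>x. 0 < \<mu> $ x"
proof -
  have \<mu>: "\<mu> \<in> prob_vectors"
    using qs by (simp add: quasi_stationary_def)
  then have \<mu>0: "\<mu> $ x \<ge> 0" and \<mu>1: "(\<Sum>x\<in>UNIV. \<mu> $ x) = 1" for x
    by (auto simp: prob_vectors_def)
  define r where "r = measure (PP \<mu>) {w \<in> space (PP \<mu>). Y 1 w \<noteq> None}"
  have "\<P>(w in PP \<mu>. Y 1 w = Some x \<bar> Y 1 w \<noteq> None) = \<mu> $ x" for x
    using qs by (simp add: quasi_stationary_def)
  moreover have "{w \<in> space (PP \<mu>). Y 1 w = Some x \<and> Y 1 w \<noteq> None}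
      = {w \<in> space (PP \<mu>). Y 1 w = Some x}" for x
    by auto
  ultimately have div: "killed_step P \<mu> $ x / r = \<mu> $ x" for x
    by (simp only: cond_prob_def r_def law_Y1[OF \<mu>])
  \<comment> \<open>Division by zero yields 0, so \<open>r = 0\<close> would turn \<open>div\<close>
    into \<open>\<mu> = 0\<close>, against total mass 1.\<close>
  have "r \<noteq> 0"
  proof
    assume "r = 0"
    with div have "\<mu> $ x = 0" for x
      by simp
    with \<mu>1 show False
      by simp
  qed
  moreover have "r \<ge> 0"
    by (simp add: r_def)
  ultimately have r: "r > 0"
    by simp
  have ev: "killed_step P \<mu> $ x = r * \<mu> $ x" for x
    using div[of x] r by (simp add: field_simps)
  obtain x0 where x0: "\<mu> $ x0 > 0"
    using \<mu>0 \<mu>1 by (metis (no_types, lifting) less_eq_real_def sum.neutral zero_neq_one)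
  have pos: "\<mu> $ x > 0" for x
  proof -
    have "{x. \<mu> $ x > 0} = UNIV"
    proof (rule closed_set_eq_UNIV)
      show "x0 \<in> {x. \<mu> $ x > 0}"
        using x0 by simp
      fix x y assume "x \<in> {x. \<mu> $ x > 0}" and xy: "P $ Some x $ Some y > 0"
      then have "0 < \<mu> $ x * P $ Some x $ Some y"
        by simp
      also have "\<dots> \<le> killed_step P \<mu> $ y"
        unfolding killed_step_def by (simp, rule member_le_sum) (auto simp: P_nonneg \<mu>0)
      finally show "y \<in> {x. \<mu> $ x > 0}"
        using r by (simp add: ev zero_less_mult_iff)
    qed
    then show ?thesis
      by auto
  qed
  obtain z where z: "P $ Some z $ None > 0"
    using exit by blast
  have "0 < \<mu> $ z * P $ Some z $ None"
    using pos z by simp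
  also have "\<dots> \<le> (\<Sum>x\<in>UNIV. \<mu> $ x * P $ Some x $ None)"
    by (rule member_le_sum) (auto simp: P_nonneg \<mu>0)
  finally have "r < 1"
    using sum_killed_step[OF stochastic, of \<mu>] \<mu>1
    by (simp add: ev algebra_simps sum_subtractf flip: sum_distrib_left)
  moreover have "killed_step P \<mu> = r *\<^sub>R \<mu>"
    by (simp add: vec_eq_iff ev)
  ultimately show ?thesis
    using that r pos by blast
qed

text \<open>A matrix and its transpose have the same determinant, so \<open>r\<close> also has a
  right eigenvector \<open>w\<close>, of unknown signs. Its absolute value satisfies the eigenvalue
  equation up to an inequality, and pairing with the positive left eigenvector \<open>\<mu>\<close>
  forces equality. Its zero set is closed under transitions, hence empty.\<close>

lemma right_eigenvector:
  assumes r: "0 < r" and ev: "killed_step P \<mu> = r *\<^sub>R \<mu>" and pos: "\<And>x. 0 < \<mu> $ x"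
  obtains v where "\<And>x. 0 < v $ x" "\<And>x. (\<Sum>y\<in>UNIV. P $ Some x $ Some y * v $ y) = r * v $ x"
proof -
  define B :: "real ^ 's ^ 's" where "B = (\<chi> x y. P $ Some x $ Some y - (if x = y then r else 0))"
  have Bt: "(transpose B *v \<mu>) $ y = killed_step P \<mu> $ y - r * \<mu> $ y" for y
    by (simp add: B_def transpose_def matrix_vector_mult_def killed_step_def left_diff_distrib
      sum_subtractf mult.commute[of "\<mu> $ _"] if_distrib[where f = "\<lambda>t. t * _"] cong: if_cong)
  have "transpose B *v \<mu> = 0"
    by (simp add: vec_eq_iff Bt ev del: transpose_matrix_vector)
  moreover have "\<mu> \<noteq> 0"
    using pos by (metis less_irrefl zero_index)
  ultimately have "\<not> invertible (transpose B)"
    unfolding invertible_left_inverse matrix_left_invertible_ker by blast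
  then have "\<not> invertible B"
    by (simp add: invertible_det_nz det_transpose)
  then obtain w where w: "B *v w = 0" "w \<noteq> 0"
    unfolding invertible_left_inverse matrix_left_invertible_ker by blast
  have Bw: "(B *v w) $ x = (\<Sum>y\<in>UNIV. P $ Some x $ Some y * w $ y) - r * w $ x" for x
    by (simp add: B_def matrix_vector_mult_def left_diff_distrib
      sum_subtractf if_distrib[where f = "\<lambda>t. t * _"] cong: if_cong)
  have Qw: "(\<Sum>y\<in>UNIV. P $ Some x $ Some y * w $ y) = r * w $ x" for x
    using Bw[of x] w(1) by simp
  define v where "v = (\<chi> x. \<bar>w $ x\<bar>)"
  have ge: "r * v $ x \<le> (\<Sum>y\<in>UNIV. P $ Some x $ Some y * v $ y)" for x
  proof -
    have "r * v $ x = \<bar>\<Sum>y\<in>UNIV. P $ Some x $ Some y * w $ y\<bar>"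
      using r by (simp add: Qw v_def abs_mult)
    also have "\<dots> \<le> (\<Sum>y\<in>UNIV. \<bar>P $ Some x $ Some y * w $ y\<bar>)"
      by (rule sum_abs)
    finally show ?thesis
      by (simp add: v_def abs_mult P_nonneg)
  qed
  \<comment> \<open>Nonnegative, and of \<open>\<mu>\<close>-weighted sum 0 because
    \<open>\<mu>\<close> is a left eigenvector for the same \<open>r\<close>; as
    \<open>\<mu>\<close> is positive, every gap vanishes.\<close>
  define gap where "gap x = (\<Sum>y\<in>UNIV. P $ Some x $ Some y * v $ y) - r * v $ x" for x
  have gap: "gap x \<ge> 0" for x
    using ge by (simp add: gap_def)
  have "(\<Sum>x\<in>UNIV. \<mu> $ x * (\<Sum>y\<in>UNIV. P $ Some x $ Some y * v $ y))
      = (\<Sum>x\<in>UNIV. \<Sum>y\<in>UNIV. \<mu> $ x * P $ Some x $ Some y * v $ y)"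
    by (simp add: sum_distrib_left mult.assoc)
  also have "\<dots> = (\<Sum>y\<in>UNIV. \<Sum>x\<in>UNIV. \<mu> $ x * P $ Some x $ Some y * v $ y)"
    by (rule sum.swap)
  also have "\<dots> = (\<Sum>y\<in>UNIV. killed_step P \<mu> $ y * v $ y)"
    by (simp add: killed_step_def sum_distrib_right)
  finally have "(\<Sum>x\<in>UNIV. \<mu> $ x * gap x) = 0"
    by (simp add: gap_def ev right_diff_distrib sum_subtractf mult.left_commute mult.assoc)
  then have "\<mu> $ x * gap x = 0" for x
    by (subst (asm) sum_nonneg_eq_0_iff) (auto simp: gap pos less_imp_le)
  then have "gap x = 0" for x
    using pos by (metis less_irrefl mult_eq_0_iff)
  then have eq: "(\<Sum>y\<in>UNIV. P $ Some x $ Some y * v $ y) = r * v $ x" for x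
    by (simp add: gap_def)
  have v0: "v $ x \<ge> 0" for x
    by (simp add: v_def)
  have "v $ x > 0" for x
  proof (rule ccontr)
    assume "\<not> v $ x > 0"
    then have x: "x \<in> {x. v $ x = 0}"
      using v0[of x] by simp
    have "{x. v $ x = 0} = UNIV"
    proof (rule closed_set_eq_UNIV[OF x])
      fix x y assume "x \<in> {x. v $ x = 0}" and xy: "P $ Some x $ Some y > 0"
      then have "(\<Sum>y\<in>UNIV. P $ Some x $ Some y * v $ y) = 0"
        by (simp add: eq)
      then have "P $ Some x $ Some y * v $ y = 0"
        by (subst (asm) sum_nonneg_eq_0_iff) (auto simp: P_nonneg v0)
      with xy show "y \<in> {x. v $ x = 0}"
        by simp
    qed
    then have "w = 0"
      by (auto simp: vec_eq_iff v_def)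
    with w(2) show False ..
  qed
  with eq that show ?thesis
    by blast
qed

text \<open>
  The operator \<open>T\<close> is the Green operator \<open>(I - Q)\<^sup>-\<^sup>1\<close> of the killed chain. It has strictly positive
  entries, so on the hyperplane orthogonal to its Perron vector \<open>v\<close> it contracts strictly more than
  on the Perron direction.
\<close>

lemma green_operator:
  assumes qs: "quasi_stationary PP Y \<mu>"
  obtains T v l c where
    "linear T" "\<And>x. T (x - killed_step P x) = x" "\<And>i. 0 < v $ i" "0 < l"
    "\<And>x. v \<bullet> T x = l * (v \<bullet> x)" "T \<mu> = l *\<^sub>R \<mu>" "0 < c" "c \<le> l"
    "\<And>x. v \<bullet> x = 0 \<Longrightarrow> weighted_norm v (T x) \<le> (l - c) * weighted_norm v x"
proof -
  obtain r where r: "0 < r" "r < 1" and ev: "killed_step P \<mu> = r *\<^sub>R \<mu>" and pos: "\<And>x. 0 < \<mu> $ x"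
    using quasi_stationary_eigenvector[OF qs] by blast
  obtain v where v: "\<And>x. 0 < v $ x"
    and Qv: "\<And>x. (\<Sum>y\<in>UNIV. P $ Some x $ Some y * v $ y) = r * v $ x"
    using right_eigenvector[OF r(1) ev pos] by blast
  have v_step: "(\<Sum>y\<in>UNIV. v $ y * (\<Sum>x\<in>UNIV. g x * P $ Some x $ Some y))
      = r * (\<Sum>x\<in>UNIV. v $ x * g x)" for g
  proof -
    have "(\<Sum>y\<in>UNIV. v $ y * (\<Sum>x\<in>UNIV. g x * P $ Some x $ Some y))
        = (\<Sum>y\<in>UNIV. \<Sum>x\<in>UNIV. g x * (P $ Some x $ Some y * v $ y))"
      by (simp add: sum_distrib_left mult_ac)
    also have "\<dots> = (\<Sum>x\<in>UNIV. \<Sum>y\<in>UNIV. g x * (P $ Some x $ Some y * v $ y))"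
      by (rule sum.swap)
    also have "\<dots> = (\<Sum>x\<in>UNIV. g x * (r * v $ x))"
      by (simp only: Qv flip: sum_distrib_left)
    also have "\<dots> = r * (\<Sum>x\<in>UNIV. v $ x * g x)"
      by (simp add: sum_distrib_left mult_ac)
    finally show ?thesis .
  qed
  \<comment> \<open>A maximum principle: pairing \<open>g \<le> g Q\<close> with \<open>v\<close>
    gives \<open>v g \<le> r (v g)\<close>, and \<open>r < 1\<close>. Applied to absolute values it
    makes I - Q injective; applied to negative parts it makes T nonnegative.\<close>
  have subharmonic_zero: "g x = 0"
    if g0: "\<And>x. g x \<ge> 0" and le: "\<And>y. g y \<le> (\<Sum>x\<in>UNIV. g x * P $ Some x $ Some y)" for g x
  proof -
    have "(\<Sum>y\<in>UNIV. v $ y * g y) \<le> r * (\<Sum>x\<in>UNIV. v $ x * g x)"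
      unfolding v_step[symmetric] using le v by (intro sum_mono mult_left_mono) (auto intro: less_imp_le)
    then have "(1 - r) * (\<Sum>y\<in>UNIV. v $ y * g y) \<le> 0"
      by (simp add: algebra_simps)
    then have "(\<Sum>y\<in>UNIV. v $ y * g y) \<le> 0"
      using r by (simp add: mult_le_0_iff)
    moreover have "(\<Sum>y\<in>UNIV. v $ y * g y) \<ge> 0"
      using g0 v by (intro sum_nonneg mult_nonneg_nonneg) (auto intro: less_imp_le)
    ultimately have "(\<Sum>y\<in>UNIV. v $ y * g y) = 0"
      by simp
    then have "v $ x * g x = 0"
      by (subst (asm) sum_nonneg_eq_0_iff) (use g0 v in \<open>auto intro!: mult_nonneg_nonneg intro: less_imp_le\<close>)
    then show ?thesis
      using v[of x] by simp
  qed
  define L where "L x = x - killed_step P x" for x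
  have linL: "linear L"
    unfolding L_def by (intro linear_compose_sub linear_killed_step) (simp add: linear_id[unfolded id_def])
  have "x = 0" if "L x = 0" for x
  proof -
    have x: "x $ y = (\<Sum>z\<in>UNIV. x $ z * P $ Some z $ Some y)" for y
    proof -
      have "L x $ y = 0"
        by (simp add: that)
      then show ?thesis
        by (simp add: L_def killed_step_def)
    qed
    have "\<bar>x $ i\<bar> = 0" for i
    proof (rule subharmonic_zero)
      fix y
      have "\<bar>x $ y\<bar> \<le> (\<Sum>z\<in>UNIV. \<bar>x $ z * P $ Some z $ Some y\<bar>)"
        by (subst x) (rule sum_abs)
      then show "\<bar>x $ y\<bar> \<le> (\<Sum>z\<in>UNIV. \<bar>x $ z\<bar> * P $ Some z $ Some y)"
        by (simp add: abs_mult P_nonneg)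
    qed simp
    then show ?thesis
      by (simp add: vec_eq_iff)
  qed
  then have "inj L"
    using linL linear_injective_0 by blast
  then obtain T where T: "linear T" "\<And>x. T (L x) = x" "\<And>x. L (T x) = x"
    using linear_injective_isomorphism[OF linL] by blast
  \<comment> \<open>The eigenvalue of the inverse of I - Q that corresponds to the eigenvalue
    \<open>r\<close> of Q.\<close>
  define l where "l = 1 / (1 - r)"
  have l: "l > 0"
    using r by (simp add: l_def)
  have vL: "v \<bullet> L x = (1 - r) * (v \<bullet> x)" for x
    using v_step[of "\<lambda>i. x $ i"]
    by (simp add: L_def inner_vec_def killed_step_def algebra_simps sum_subtractf)
  have vT: "v \<bullet> T x = l * (v \<bullet> x)" for x
    using vL[of "T x"] r by (simp add: T(3) l_def field_simps)
  have "T (L \<mu>) = (1 - r) *\<^sub>R T \<mu>"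
    by (simp add: L_def ev linear_diff[OF T(1)] linear_scale[OF T(1)] algebra_simps)
  then have "\<mu> = (1 - r) *\<^sub>R T \<mu>"
    by (simp add: T(2))
  then have "l *\<^sub>R \<mu> = l *\<^sub>R ((1 - r) *\<^sub>R T \<mu>)"
    by simp
  then have T\<mu>: "T \<mu> = l *\<^sub>R \<mu>"
    using r by (simp add: l_def)
  \<comment> \<open>The row \<open>z\<close> of T at \<open>x\<close> solves
    \<open>z = axis x 1 + z Q\<close>. Its negative part is subharmonic, hence 0; then
    \<open>z\<close> is at least 1 at \<open>x\<close>, and its support is closed under
    transitions.\<close>
  have Tpos: "T (axis x 1) $ y > 0" for x y
  proof -
    define z where "z = T (axis x 1)"
    have zeq: "z $ y = axis x 1 $ y + (\<Sum>i\<in>UNIV. z $ i * P $ Some i $ Some y)" for y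
    proof -
      have "L z $ y = axis x 1 $ y"
        by (simp add: z_def T(3))
      then show ?thesis
        by (simp add: L_def killed_step_def)
    qed
    have "max 0 (- z $ i) = 0" for i
    proof (rule subharmonic_zero)
      fix y
      have "- z $ y \<le> (\<Sum>i\<in>UNIV. - z $ i * P $ Some i $ Some y)"
        by (subst zeq) (simp add: axis_def sum_negf)
      also have "\<dots> \<le> (\<Sum>i\<in>UNIV. max 0 (- z $ i) * P $ Some i $ Some y)"
        by (intro sum_mono mult_right_mono) (auto simp: P_nonneg)
      finally show "max 0 (- z $ y) \<le> (\<Sum>i\<in>UNIV. max 0 (- z $ i) * P $ Some i $ Some y)"
        by (auto intro!: sum_nonneg simp: P_nonneg)
    qed simp
    then have z0: "z $ i \<ge> 0" for i
      by (smt (verit))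
    have zx: "x \<in> {i. z $ i > 0}"
    proof -
      have "(\<Sum>i\<in>UNIV. z $ i * P $ Some i $ Some x) \<ge> 0"
        by (intro sum_nonneg mult_nonneg_nonneg z0 P_nonneg)
      with zeq[of x] show ?thesis
        by simp
    qed
    have "{i. z $ i > 0} = UNIV"
    proof (rule closed_set_eq_UNIV[OF zx])
      fix i y assume "i \<in> {i. z $ i > 0}" "P $ Some i $ Some y > 0"
      then have "0 < z $ i * P $ Some i $ Some y"
        by simp
      also have "\<dots> \<le> (\<Sum>i\<in>UNIV. z $ i * P $ Some i $ Some y)"
        by (rule member_le_sum) (auto simp: P_nonneg z0)
      also have "\<dots> \<le> z $ y"
        by (subst (2) zeq) (simp add: axis_def)
      finally show "y \<in> {i. z $ i > 0}"
        by simp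
    qed
    then show ?thesis
      by (auto simp: z_def)
  qed
  define G where "G x y = T (axis x 1) $ y" for x y
  have TG: "T x $ y = (\<Sum>i\<in>UNIV. x $ i * G i y)" for x y
  proof -
    have "T x = T (\<Sum>i\<in>UNIV. x $ i *s axis i 1)"
      by (simp add: basis_expansion)
    also have "\<dots> = (\<Sum>i\<in>UNIV. x $ i *\<^sub>R T (axis i 1))"
      by (simp add: linear_sum[OF T(1)] linear_scale[OF T(1)] scalar_mult_eq_scaleR)
    finally show ?thesis
      by (simp add: G_def)
  qed
  have Gv: "(\<Sum>y\<in>UNIV. v $ y * G x y) = l * v $ x" for x
  proof -
    have "(\<Sum>y\<in>UNIV. v $ y * G x y) = v \<bullet> T (axis x 1)"
      by (simp add: G_def inner_vec_def)
    then show ?thesis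
      by (simp add: vT inner_axis)
  qed
  \<comment> \<open>A Doeblin constant: the entries of T dominate the rank-one matrix
    \<open>e * v $ x\<close>. Subtracting that matrix does not change T on vectors orthogonal to
    \<open>v\<close>, and it lowers the \<open>v\<close>-weighted row sums from
    \<open>l * v $ x\<close> to \<open>(l - c) * v $ x\<close>.\<close>
  define e where "e = Min ((\<lambda>(x, y). G x y / v $ x) ` UNIV)"
  have e: "e > 0"
    unfolding e_def using Tpos v by (subst Min_gr_iff) (auto simp: G_def)
  have eG: "e * v $ x \<le> G x y" for x y
  proof -
    have "e \<le> (\<lambda>(x, y). G x y / v $ x) (x, y)"
      unfolding e_def by (rule Min_le) (auto intro!: imageI simp del: case_prod_conv)
    then show ?thesis
      using v[of x] by (simp add: field_simps)
  qed
  define c where "c = e * (\<Sum>y\<in>UNIV. v $ y)"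
  have "(\<Sum>y\<in>UNIV. v $ y) > 0"
    using v by (intro sum_pos) auto
  then have c: "c > 0"
    using e by (simp add: c_def)
  have cl: "c \<le> l"
  proof -
    fix x :: 's
    have "c * v $ x = (\<Sum>y\<in>UNIV. v $ y * (e * v $ x))"
      by (simp add: c_def sum_distrib_left sum_distrib_right mult_ac)
    also have "\<dots> \<le> l * v $ x"
      unfolding Gv[symmetric] using eG v by (intro sum_mono mult_left_mono) (auto intro: less_imp_le)
    finally show ?thesis
      using v[of x] by simp
  qed
  have "weighted_norm v (T x) \<le> (l - c) * weighted_norm v x" if "v \<bullet> x = 0" for x
  proof -
    have vx: "(\<Sum>i\<in>UNIV. x $ i * v $ i) = 0"
      using that by (simp add: inner_vec_def mult.commute)
    have T_le: "\<bar>T x $ y\<bar> \<le> (\<Sum>i\<in>UNIV. \<bar>x $ i\<bar> * (G i y - e * v $ i))" for y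
    proof -
      have "T x $ y = (\<Sum>i\<in>UNIV. x $ i * G i y) - e * (\<Sum>i\<in>UNIV. x $ i * v $ i)"
        by (simp add: TG vx)
      also have "\<dots> = (\<Sum>i\<in>UNIV. x $ i * (G i y - e * v $ i))"
        by (simp add: sum_distrib_left algebra_simps sum_subtractf)
      finally have "\<bar>T x $ y\<bar> \<le> (\<Sum>i\<in>UNIV. \<bar>x $ i * (G i y - e * v $ i)\<bar>)"
        by (simp only: sum_abs)
      then show ?thesis
        using eG by (simp add: abs_mult)
    qed
    have "weighted_norm v (T x) \<le> (\<Sum>y\<in>UNIV. v $ y * (\<Sum>i\<in>UNIV. \<bar>x $ i\<bar> * (G i y - e * v $ i)))"
      unfolding weighted_norm_def using T_le v
      by (intro sum_mono mult_left_mono) (auto intro: less_imp_le)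
    also have "\<dots> = (\<Sum>y\<in>UNIV. \<Sum>i\<in>UNIV. \<bar>x $ i\<bar> * (v $ y * G i y - e * v $ i * v $ y))"
      by (simp add: sum_distrib_left algebra_simps)
    also have "\<dots> = (\<Sum>i\<in>UNIV. \<Sum>y\<in>UNIV. \<bar>x $ i\<bar> * (v $ y * G i y - e * v $ i * v $ y))"
      by (rule sum.swap)
    also have "\<dots> = (\<Sum>i\<in>UNIV. \<bar>x $ i\<bar> * (l * v $ i - c * v $ i))"
      by (simp add: sum_subtractf Gv c_def mult_ac flip: sum_distrib_left)
    also have "\<dots> = (l - c) * weighted_norm v x"
      by (simp add: weighted_norm_def sum_distrib_left algebra_simps)
    finally show ?thesis .
  qed
  with T v l vT T\<mu> c cl that show ?thesis
    unfolding L_def by blast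
qed

end

section \<open>Linear recursions with vanishing perturbations\<close>

lemma not_summable_tail_sum_large:
  fixes s :: "nat \<Rightarrow> real"
  assumes s0: "\<And>n. 0 \<le> s n" and ns: "\<not> summable s"
  shows "\<exists>k. C < (\<Sum>i<k. s (N + i))"
proof (rule ccontr)
  assume "\<not> ?thesis"
  then have "summable (\<lambda>i. s (N + i))"
    by (intro summableI_nonneg_bounded[of _ C]) (auto simp: s0 not_less)
  then show False
    using ns summable_iff_shift[of s N] by (simp add: add.commute)
qed

text \<open>Once \<open>h n\<close> is below a level \<open>e\<close>, the excess of
  \<open>u\<close> over \<open>e\<close> shrinks at each step by the factor
  \<open>exp (- s n)\<close>, and divergence of the series of \<open>s\<close> sends the product of
  these factors to 0.\<close>

lemma averaging_recursion_tendsto_0: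
  fixes u s h :: "nat \<Rightarrow> real"
  assumes u0: "\<And>n. 0 \<le> u n" and s0: "\<And>n. 0 \<le> s n"
    and s1: "\<forall>\<^sub>F n in sequentially. s n \<le> 1"
    and ns: "\<not> summable s" and h: "h \<longlonglongrightarrow> 0"
    and rec: "\<forall>\<^sub>F n in sequentially. u (Suc n) \<le> (1 - s n) * u n + s n * h n"
  shows "u \<longlonglongrightarrow> 0"
proof (rule LIMSEQ_I)
  fix r :: real assume "r > 0"
  define e where "e = r / 2"
  have e: "e > 0"
    using \<open>r > 0\<close> by (simp add: e_def)
  have "\<forall>\<^sub>F n in sequentially. h n < e"
    using h e by (rule order_tendstoD)
  then have "\<forall>\<^sub>F n in sequentially. h n < e \<and> s n \<le> 1 \<and> u (Suc n) \<le> (1 - s n) * u n + s n * h n"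
    using s1 rec by eventually_elim auto
  then obtain N where N: "\<And>n. n \<ge> N \<Longrightarrow> h n < e \<and> s n \<le> 1 \<and> u (Suc n) \<le> (1 - s n) * u n + s n * h n"
    by (auto simp: eventually_sequentially)
  define w where "w n = max 0 (u n - e)" for n
  have w_step: "w (Suc n) \<le> exp (- s n) * w n" if "n \<ge> N" for n
  proof -
    have "s n * h n \<le> s n * e"
      using N[OF that] s0 by (intro mult_left_mono) auto
    then have "u (Suc n) - e \<le> (1 - s n) * (u n - e)"
      using N[OF that] by (simp add: algebra_simps)
    also have "\<dots> \<le> (1 - s n) * w n"
      using N[OF that] by (intro mult_left_mono) (auto simp: w_def)
    also have "\<dots> \<le> exp (- s n) * w n"
      using exp_ge_add_one_self[of "- s n"] by (intro mult_right_mono) (auto simp: w_def)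
    finally show ?thesis
      by (auto simp: w_def)
  qed
  have w_bound: "w (N + k) \<le> exp (- (\<Sum>i<k. s (N + i))) * w N" for k
  proof (induction k)
    case (Suc k)
    have "w (N + Suc k) \<le> exp (- s (N + k)) * w (N + k)"
      using w_step[of "N + k"] by simp
    also have "\<dots> \<le> exp (- s (N + k)) * (exp (- (\<Sum>i<k. s (N + i))) * w N)"
      using Suc by (intro mult_left_mono) auto
    also have "\<dots> = exp (- (\<Sum>i<Suc k. s (N + i))) * w N"
      by (simp add: mult_exp_exp flip: mult.assoc)
    finally show ?case .
  qed simp
  \<comment> \<open>Chosen so that the accumulated factor is at most \<open>e / (w N + 1)\<close>;
    the added 1 keeps the logarithm meaningful when \<open>w N = 0\<close> and the final bound
    strict.\<close>
  obtain k where k: "ln ((w N + 1) / e) < (\<Sum>i<k. s (N + i))"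
    using not_summable_tail_sum_large[OF s0 ns] by blast
  have wN: "w N \<ge> 0"
    by (simp add: w_def)
  have "u n < r" if n: "n \<ge> N + k" for n
  proof -
    define j where "j = n - N"
    have j: "n = N + j" "k \<le> j"
      using n by (auto simp: j_def)
    have "(\<Sum>i<k. s (N + i)) \<le> (\<Sum>i<j. s (N + i))"
      using j(2) s0 by (intro sum_mono2) auto
    with k have "exp (- (\<Sum>i<j. s (N + i))) \<le> exp (- ln ((w N + 1) / e))"
      by simp
    also have "\<dots> = e / (w N + 1)"
      using wN e by (simp add: exp_minus)
    finally have "w n \<le> e / (w N + 1) * w N"
      using w_bound[of j] wN j(1) by (meson mult_right_mono order_trans)
    also have "\<dots> < e"
      using wN e by (simp add: field_simps)
    finally show ?thesis
      unfolding w_def e_def by linarith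
  qed
  then show "\<exists>no. \<forall>n\<ge>no. norm (u n - 0) < r"
    using u0 by (intro exI[of _ "N + k"]) auto
qed

text \<open>Here \<open>z n\<close> need not be small and \<open>1 - z n\<close> may be negative;
  only the weighted series of \<open>z\<close> converges. Its partial sums are bounded, so
  \<open>exp (- Z n)\<close> is an integrating factor bounded above and away from 0:
  \<open>u n = exp (- Z n) * y n\<close> decays at the plain rate \<open>k * g n\<close> and is
  comparable with \<open>y n\<close>.\<close>

lemma perturbed_recursion_tendsto_0:
  fixes y g z h :: "nat \<Rightarrow> real"
  assumes y0: "\<And>n. 0 \<le> y n" and g0: "\<And>n. 0 \<le> g n" and g: "g \<longlonglongrightarrow> 0"
    and ng: "\<not> summable g" and gz: "summable (\<lambda>n. g n * z n)" and h: "h \<longlonglongrightarrow> 0"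
    and k: "k > 0"
    and rec: "\<forall>\<^sub>F n in sequentially. y (Suc n) \<le> exp (- (k * g n * (1 - z n))) * y n + g n * h n"
  shows "y \<longlonglongrightarrow> 0"
proof -
  define Z where "Z n = k * (\<Sum>i<n. g i * z i)" for n
  have "convergent (\<lambda>n. \<Sum>i<n. g i * z i)"
    using gz by (simp add: summable_iff_convergent)
  then have "convergent Z"
    unfolding Z_def by (intro convergent_mult) (auto intro: convergent_const)
  then have "Bseq Z"
    by (rule convergent_imp_Bseq)
  then obtain B where B: "\<And>n. \<bar>Z n\<bar> \<le> B"
    by (auto simp: Bseq_def)
  define u where "u n = exp (- Z n) * y n" for n
  \<comment> \<open>Half the rate, because \<open>exp (- t) \<le> 1 - t / 2\<close> for
    \<open>t\<close> between 0 and 1.\<close>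
  define s where "s n = k / 2 * g n" for n
  define h' where "h' n = 2 / k * exp B * \<bar>h n\<bar>" for n
  have "u \<longlonglongrightarrow> 0"
  proof (rule averaging_recursion_tendsto_0)
    show "0 \<le> u n" for n
      by (simp add: u_def y0)
    show "0 \<le> s n" for n
      using k g0 by (simp add: s_def)
    have "s \<longlonglongrightarrow> k / 2 * 0"
      unfolding s_def by (intro tendsto_intros g)
    then have s_lt: "\<forall>\<^sub>F n in sequentially. s n < 1 / 2"
      by (rule order_tendstoD) simp
    then show "\<forall>\<^sub>F n in sequentially. s n \<le> 1"
      by eventually_elim simp
    show "\<not> summable s"
      unfolding s_def summable_cmult_iff using ng k by simp
    have "h' \<longlonglongrightarrow> 2 / k * exp B * \<bar>0\<bar>"
      unfolding h'_def by (intro tendsto_intros h)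
    then show "h' \<longlonglongrightarrow> 0"
      by simp
    show "\<forall>\<^sub>F n in sequentially. u (Suc n) \<le> (1 - s n) * u n + s n * h' n"
      using s_lt rec
    proof eventually_elim
      case (elim n)
      define t where "t = k * g n"
      have t: "0 \<le> t" "t \<le> 1"
        using k g0 elim(1) by (auto simp: t_def s_def)
      have "1 \<le> (1 - t / 2) * (1 + t)"
        using t mult_left_le_one_le[of t t] by (simp add: algebra_simps)
      also have "\<dots> \<le> (1 - t / 2) * exp t"
        using t exp_ge_add_one_self[of t] by (intro mult_left_mono) auto
      finally have exp_t: "exp (- t) \<le> 1 - t / 2"
        by (simp add: exp_minus field_simps)
      have ZS: "Z (Suc n) = Z n + t * z n"
        by (simp add: Z_def t_def algebra_simps)
      have "u (Suc n) \<le> exp (- Z (Suc n)) * (exp (- (t * (1 - z n))) * y n + g n * h n)"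
        unfolding u_def using elim(2) by (intro mult_left_mono) (auto simp: t_def)
      also have "\<dots> = exp (- t) * u n + g n * (exp (- Z (Suc n)) * h n)"
        by (simp add: u_def ZS algebra_simps exp_add exp_diff exp_minus field_simps)
      also have "\<dots> \<le> (1 - s n) * u n + g n * (exp B * \<bar>h n\<bar>)"
      proof (intro add_mono mult_right_mono mult_left_mono g0)
        show "exp (- t) \<le> 1 - s n"
          using exp_t by (simp add: s_def t_def)
        show "0 \<le> u n"
          by (simp add: u_def y0)
        have "exp (- Z (Suc n)) * h n \<le> exp (- Z (Suc n)) * \<bar>h n\<bar>"
          by (intro mult_left_mono) auto
        also have "\<dots> \<le> exp B * \<bar>h n\<bar>"
          using B[of "Suc n"] by (intro mult_right_mono) auto
        finally show "exp (- Z (Suc n)) * h n \<le> exp B * \<bar>h n\<bar>" .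
      qed
      also have "g n * (exp B * \<bar>h n\<bar>) = s n * h' n"
        using k by (simp add: s_def h'_def)
      finally show ?case .
    qed
  qed
  moreover have "y n \<le> exp B * u n" for n
  proof -
    have "1 * y n \<le> (exp B * exp (- Z n)) * y n"
      using B[of n] y0 by (intro mult_right_mono) (auto simp: mult_exp_exp)
    then show ?thesis
      by (simp add: u_def mult.assoc)
  qed
  ultimately show ?thesis
    using y0 tendsto_mult_left[of u 0 sequentially "exp B"]
    by (intro tendsto_sandwich[OF _ _ tendsto_const, of 0 y sequentially "\<lambda>n. exp B * u n"]) auto
qed

text \<open>Summation by parts leaves a telescoping series, convergent since
  \<open>g n *\<^sub>R m n\<close> tends to 0, and a series dominated by the decrements of
  \<open>g\<close>.\<close>

lemma summable_weighted_increments: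
  fixes m :: "nat \<Rightarrow> 'a::banach" and g :: "nat \<Rightarrow> real"
  assumes g: "decseq g" "g \<longlonglongrightarrow> 0" and m: "\<And>n. norm (m n) \<le> B"
  shows "summable (\<lambda>n. g n *\<^sub>R (m (Suc n) - m n))"
proof -
  have g0: "g n \<ge> 0" for n
    using g by (rule decseq_ge)
  have "(\<lambda>n. g n *\<^sub>R m n) \<longlonglongrightarrow> 0"
  proof (rule Lim_null_comparison)
    show "\<forall>\<^sub>F n in sequentially. norm (g n *\<^sub>R m n) \<le> g n * B"
      using m g0 by (auto intro!: always_eventually mult_left_mono)
    show "(\<lambda>n. g n * B) \<longlonglongrightarrow> 0"
      using tendsto_mult_right[OF g(2), of B] by simp
  qed
  then have "summable (\<lambda>n. g (Suc n) *\<^sub>R m (Suc n) - g n *\<^sub>R m n)"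
    by (rule telescope_summable)
  moreover have "summable (\<lambda>n. (g n - g (Suc n)) *\<^sub>R m (Suc n))"
  proof (rule summable_comparison_test)
    show "\<exists>N. \<forall>n\<ge>N. norm ((g n - g (Suc n)) *\<^sub>R m (Suc n)) \<le> (g n - g (Suc n)) * B"
      using m decseq_SucD[OF g(1)] by (auto intro!: exI[of _ 0] mult_left_mono)
    show "summable (\<lambda>n. (g n - g (Suc n)) * B)"
      by (intro summable_mult2 telescope_summable'[OF g(2)])
  qed
  ultimately have "summable (\<lambda>n. (g (Suc n) *\<^sub>R m (Suc n) - g n *\<^sub>R m n) + (g n - g (Suc n)) *\<^sub>R m (Suc n))"
    by (rule summable_add)
  then show ?thesis
    by (simp add: algebra_simps)
qed

section \<open>Elementary facts on the weighted norm and on probability vectors\<close>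

lemma weighted_norm_nonneg: "(\<And>i. 0 \<le> v $ i) \<Longrightarrow> 0 \<le> weighted_norm v x"
  by (simp add: weighted_norm_def sum_nonneg)

lemma weighted_norm_triangle:
  "(\<And>i. 0 \<le> v $ i) \<Longrightarrow> weighted_norm v (x + y) \<le> weighted_norm v x + weighted_norm v y"
  unfolding weighted_norm_def sum.distrib[symmetric]
  by (intro sum_mono) (simp add: mult_left_mono abs_triangle_ineq flip: distrib_left)

lemma weighted_norm_scaleR: "weighted_norm v (a *\<^sub>R x) = \<bar>a\<bar> * weighted_norm v x"
  by (simp add: weighted_norm_def abs_mult sum_distrib_left mult_ac)

lemma tendsto_weighted_norm:
  "(f \<longlongrightarrow> x) A \<Longrightarrow> ((\<lambda>n. weighted_norm v (f n)) \<longlongrightarrow> weighted_norm v x) A"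
  unfolding weighted_norm_def by (intro tendsto_intros)

lemma weighted_norm_tendsto_0D:
  assumes v: "\<And>i. 0 < v $ i" and lim: "((\<lambda>n. weighted_norm v (f n)) \<longlongrightarrow> 0) A"
  shows "(f \<longlongrightarrow> 0) A"
proof (rule vec_tendstoI)
  fix i
  have le: "\<bar>f n $ i\<bar> \<le> weighted_norm v (f n) / v $ i" for n
  proof -
    have "v $ i * \<bar>f n $ i\<bar> \<le> weighted_norm v (f n)"
      unfolding weighted_norm_def by (rule member_le_sum) (auto intro!: mult_nonneg_nonneg intro: less_imp_le v)
    then show ?thesis
      using v[of i] by (simp add: field_simps)
  qed
  have "((\<lambda>n. weighted_norm v (f n) / v $ i) \<longlongrightarrow> 0) A"
    using tendsto_divide[OF lim tendsto_const[of "v $ i"]] v[of i] by simp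
  then have "((\<lambda>n. f n $ i) \<longlongrightarrow> 0) A"
    by (rule Lim_null_comparison[rotated]) (auto simp: le)
  then show "((\<lambda>n. f n $ i) \<longlongrightarrow> 0 $ i) A"
    by simp
qed

lemma prob_vectors_norm_le:
  assumes "\<mu> \<in> prob_vectors"
  shows "norm \<mu> \<le> 1"
proof -
  have "norm \<mu> \<le> (\<Sum>i\<in>UNIV. \<bar>\<mu> $ i\<bar>)"
    by (rule norm_le_l1_cart)
  then show ?thesis
    using assms by (simp add: prob_vectors_def)
qed

lemma prob_vectors_inner_1:
  "\<mu> \<in> prob_vectors \<Longrightarrow> 1 \<bullet> \<mu> = 1"
  by (simp add: prob_vectors_def inner_vec_def)

lemma weighted_norm_le_norm:
  assumes "\<And>i. 0 \<le> v $ i"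
  shows "weighted_norm v x \<le> (\<Sum>i\<in>UNIV. v $ i) * norm x"
  unfolding weighted_norm_def sum_distrib_right
  by (intro sum_mono mult_left_mono component_le_norm_cart assms)

text \<open>
  Solving the occupation equation for \<open>m (Suc n)\<close> with the Green operator makes the recursion for
  \<open>th\<close> linear in \<open>th\<close> up to a noise whose weighted sum converges. Adding the tail of that sum to
  \<open>th\<close> absorbs the noise, and the component transversal to the Perron direction then decays
  relative to the component along it.
\<close>

lemma occupation_recursion_converges:
  fixes A T :: "real ^ 's::finite \<Rightarrow> real ^ 's" and th m e :: "nat \<Rightarrow> real ^ 's" and g :: "nat \<Rightarrow> real"
  assumes T: "linear T" and TA: "\<And>x. T (x - A x) = x"
    and v: "\<And>i. 0 < v $ i" and l: "0 < l" and vT: "\<And>x. v \<bullet> T x = l * (v \<bullet> x)"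
    and T\<mu>: "T \<mu> = l *\<^sub>R \<mu>" and c: "0 < c" "c \<le> l"
    and contr: "\<And>x. v \<bullet> x = 0 \<Longrightarrow> weighted_norm v (T x) \<le> (l - c) * weighted_norm v x"
    and \<mu>: "\<mu> \<in> prob_vectors"
    and q: "\<And>i. 0 \<le> q $ i" "\<And>i. q $ i \<le> 1"
    and th: "\<And>n. th n \<in> prob_vectors" and m: "\<And>n. m n \<in> prob_vectors"
    and th_step: "\<And>n. th (Suc n) = (1 - g n) *\<^sub>R th n + g n *\<^sub>R m (Suc n)"
    and m_step: "\<And>n. m (Suc n) = A (m n) + (q \<bullet> m n) *\<^sub>R th n + e n"
    and e: "summable (\<lambda>n. g n *\<^sub>R e n)"
    and g: "decseq g" "g \<longlonglongrightarrow> 0" "\<And>n. g n < 1" "\<not> summable g"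
  shows "th \<longlonglongrightarrow> \<mu>"
proof -
  have g0: "0 \<le> g n" for n
    using g(1,2) by (rule decseq_ge)
  have v0: "0 \<le> v $ i" for i
    using v[of i] by simp
  have blT: "bounded_linear T"
    using T by (simp add: linear_conv_bounded_linear)
  note Tlin = linear_add[OF T] linear_diff[OF T] linear_scale[OF T]
  define \<rho> where "\<rho> n = q \<bullet> m n" for n
  have \<rho>0: "0 \<le> \<rho> n" for n
    using m[of n] q(1) by (auto simp: \<rho>_def inner_vec_def prob_vectors_def intro!: sum_nonneg)
  have \<rho>1: "\<rho> n \<le> 1" for n
  proof -
    have "\<rho> n \<le> (\<Sum>i\<in>UNIV. 1 * m n $ i)"
      unfolding \<rho>_def inner_vec_def inner_real_def
      using q(2) m[of n] by (intro sum_mono mult_right_mono) (auto simp: prob_vectors_def)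
    then show ?thesis
      using m[of n] by (simp add: prob_vectors_def)
  qed

  define d where "d n = m (Suc n) - m n" for n
  \<comment> \<open>Writing \<open>m n\<close> for \<open>m (Suc n)\<close> on the left of the
    occupation equation costs \<open>d n\<close>, which enters once under \<open>T\<close> and once
    when passing back to \<open>m (Suc n)\<close>.\<close>
  define f where "f n = T (e n - d n) + d n" for n
  have m_eq: "m (Suc n) = \<rho> n *\<^sub>R T (th n) + f n" for n
  proof -
    have "m n = T (m n - A (m n))"
      by (simp add: TA)
    also have "m n - A (m n) = \<rho> n *\<^sub>R th n + (e n - d n)"
      using m_step[of n] by (simp add: \<rho>_def d_def algebra_simps)
    finally have "m n = \<rho> n *\<^sub>R T (th n) + T (e n - d n)"
      by (simp add: Tlin)
    moreover have "m (Suc n) = m n + d n"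
      by (simp add: d_def)
    ultimately show ?thesis
      by (simp add: f_def algebra_simps)
  qed
  have gd: "summable (\<lambda>n. g n *\<^sub>R d n)"
    unfolding d_def
    by (rule summable_weighted_increments[OF g(1,2) prob_vectors_norm_le]) (rule m)
  have gf: "summable (\<lambda>n. g n *\<^sub>R f n)"
  proof -
    have "summable (\<lambda>n. T (g n *\<^sub>R e n - g n *\<^sub>R d n) + g n *\<^sub>R d n)"
      by (intro summable_add bounded_linear.summable[OF blT] summable_diff e gd)
    then show ?thesis
      by (simp add: f_def Tlin algebra_simps)
  qed

  define R where "R n = suminf (\<lambda>n. g n *\<^sub>R f n) - (\<Sum>i<n. g i *\<^sub>R f i)" for n
  have R_step: "R n = g n *\<^sub>R f n + R (Suc n)" for n
    by (simp add: R_def)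
  have R: "R \<longlonglongrightarrow> 0"
    unfolding R_def using tendsto_diff[OF tendsto_const summable_LIMSEQ[OF gf], of "suminf (\<lambda>n. g n *\<^sub>R f n)"]
    by simp
  \<comment> \<open>\<open>R\<close> is the tail of the noise series. In the recursion for
    \<open>tt\<close> the term \<open>g n *\<^sub>R f n\<close>, whose series merely converges,
    cancels against the decrement of \<open>R\<close>; what remains is
    \<open>g n *\<^sub>R \<delta> n\<close> with \<open>\<delta>\<close> tending to 0.\<close>
  define tt where "tt n = th n + R n" for n
  define \<delta> where "\<delta> n = R n - \<rho> n *\<^sub>R T (R n)" for n
  have tt_step: "tt (Suc n) = (1 - g n) *\<^sub>R tt n + (g n * \<rho> n) *\<^sub>R T (tt n) + g n *\<^sub>R \<delta> n" for n
  proof -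
    have "tt (Suc n) = (1 - g n) *\<^sub>R th n + (g n * \<rho> n) *\<^sub>R T (th n) + R n"
      by (simp add: tt_def th_step m_eq R_step[of n] algebra_simps)
    then show ?thesis
      by (simp add: tt_def \<delta>_def Tlin algebra_simps)
  qed
  have TR: "(\<lambda>n. T (R n)) \<longlonglongrightarrow> 0"
    using bounded_linear.tendsto[OF blT R] by (simp add: linear_0[OF T])
  have "(\<lambda>n. \<rho> n *\<^sub>R T (R n)) \<longlonglongrightarrow> 0"
  proof (rule Lim_null_comparison)
    show "\<forall>\<^sub>F n in sequentially. norm (\<rho> n *\<^sub>R T (R n)) \<le> norm (T (R n))"
      using \<rho>0 \<rho>1 by (auto intro!: always_eventually mult_left_le_one_le)
    show "(\<lambda>n. norm (T (R n))) \<longlonglongrightarrow> 0"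
      using tendsto_norm[OF TR] by simp
  qed
  then have \<delta>: "\<delta> \<longlonglongrightarrow> 0"
    unfolding \<delta>_def using tendsto_diff[OF R] by fastforce

  \<comment> \<open>This bounds \<open>v \<bullet> p\<close> below uniformly over probability
    vectors and so keeps the Perron component \<open>a n\<close> away from 0.\<close>
  obtain \<kappa> where \<kappa>: "0 < \<kappa>" "\<And>i. \<kappa> \<le> v $ i"
  proof
    show "0 < Min (range (($) v))"
      using v by (subst Min_gr_iff) auto
    show "Min (range (($) v)) \<le> v $ i" for i
      by (rule Min_le) auto
  qed
  have v_prob: "\<kappa> \<le> v \<bullet> p" if "p \<in> prob_vectors" for p
  proof -
    have "(\<Sum>i\<in>UNIV. \<kappa> * p $ i) \<le> (\<Sum>i\<in>UNIV. v $ i * p $ i)"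
      using that \<kappa> by (intro sum_mono mult_right_mono) (auto simp: prob_vectors_def)
    then show ?thesis
      using that by (simp add: inner_vec_def prob_vectors_def flip: sum_distrib_left)
  qed
  define \<beta> where "\<beta> = v \<bullet> \<mu>"
  have \<beta>: "0 < \<beta>"
    using v_prob[OF \<mu>] \<kappa>(1) by (simp add: \<beta>_def)
  \<comment> \<open>Spectral decomposition of \<open>tt n\<close>: \<open>a n / \<beta>\<close> is
    the coefficient along \<open>\<mu>\<close>, and \<open>x n\<close> the part in the kernel of
    \<open>v\<close>. The first is multiplied by \<open>\<alpha> n\<close>, the second by at most
    \<open>\<alpha> n - c * g n * \<rho> n\<close>, up to terms of order \<open>g n\<close> times
    something vanishing. Since \<open>\<alpha> n\<close> may exceed 1, only the ratio is
    controlled.\<close>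
  define a where "a n = v \<bullet> tt n" for n
  define \<alpha> where "\<alpha> n = 1 - g n + g n * \<rho> n * l" for n
  have a_step: "a (Suc n) = \<alpha> n * a n + g n * (v \<bullet> \<delta> n)" for n
    by (simp add: a_def tt_step \<alpha>_def vT algebra_simps inner_add_right inner_diff_right)
  define x where "x n = tt n - (a n / \<beta>) *\<^sub>R \<mu>" for n
  have vx: "v \<bullet> x n = 0" for n
    using \<beta> by (simp add: x_def a_def inner_diff_right flip: \<beta>_def)
  define \<delta>' where "\<delta>' n = \<delta> n - ((v \<bullet> \<delta> n) / \<beta>) *\<^sub>R \<mu>" for n
  have x_step: "x (Suc n) = (1 - g n) *\<^sub>R x n + (g n * \<rho> n) *\<^sub>R T (x n) + g n *\<^sub>R \<delta>' n" for n
  proof -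
    have "a (Suc n) / \<beta> = (1 - g n) * (a n / \<beta>) + g n * \<rho> n * (a n / \<beta> * l) + g n * ((v \<bullet> \<delta> n) / \<beta>)"
      using \<beta> by (simp add: a_step \<alpha>_def field_simps)
    then show ?thesis
      by (simp add: x_def \<delta>'_def tt_step Tlin T\<mu> algebra_simps)
  qed
  have x_le: "weighted_norm v (x (Suc n))
      \<le> (\<alpha> n - c * g n * \<rho> n) * weighted_norm v (x n) + g n * weighted_norm v (\<delta>' n)" for n
  proof -
    have "weighted_norm v (x (Suc n)) \<le> (1 - g n) * weighted_norm v (x n)
        + g n * \<rho> n * weighted_norm v (T (x n)) + g n * weighted_norm v (\<delta>' n)"
      unfolding x_step
      using weighted_norm_triangle[OF v0, of "(1 - g n) *\<^sub>R x n + (g n * \<rho> n) *\<^sub>R T (x n)" "g n *\<^sub>R \<delta>' n"]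
        weighted_norm_triangle[OF v0, of "(1 - g n) *\<^sub>R x n" "(g n * \<rho> n) *\<^sub>R T (x n)"]
        g0[of n] g(3)[of n] \<rho>0[of n]
      by (simp add: weighted_norm_scaleR)
    also have "\<dots> \<le> (1 - g n) * weighted_norm v (x n)
        + g n * \<rho> n * ((l - c) * weighted_norm v (x n)) + g n * weighted_norm v (\<delta>' n)"
      by (intro add_mono mult_left_mono contr vx mult_nonneg_nonneg g0 \<rho>0 order_refl)
    finally show ?thesis
      by (simp add: \<alpha>_def algebra_simps)
  qed

  have vR: "(\<lambda>n. v \<bullet> R n) \<longlonglongrightarrow> 0"
    using tendsto_inner[OF tendsto_const[of v] R] by simp
  have "\<forall>\<^sub>F n in sequentially. - (\<kappa> / 2) < v \<bullet> R n"
    using vR \<kappa>(1) by (intro order_tendstoD) auto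
  then have a_low: "\<forall>\<^sub>F n in sequentially. \<kappa> / 2 < a n"
  proof eventually_elim
    case (elim n)
    then show ?case
      using v_prob[OF th[of n]] by (simp add: a_def tt_def inner_add_right)
  qed
  have "Bseq R"
    using R by (intro convergent_imp_Bseq convergentI)
  then obtain D where D: "\<And>n. norm (R n) \<le> D"
    by (auto simp: Bseq_def)
  have tt_bound: "norm (tt n) \<le> 1 + D" for n
    unfolding tt_def using norm_triangle_ineq[of "th n" "R n"] D[of n] prob_vectors_norm_le[OF th[of n]]
    by simp
  have a_bound: "\<bar>a n\<bar> \<le> norm v * (1 + D)" for n
    unfolding a_def using Cauchy_Schwarz_ineq2[of v "tt n"] mult_left_mono[OF tt_bound[of n] norm_ge_zero[of v]]
    by simp
  define K where "K = (\<Sum>i\<in>UNIV. v $ i) * ((1 + D) + norm v * (1 + D) / \<beta> * norm \<mu>)"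
  have K: "weighted_norm v (x n) \<le> K" for n
  proof -
    have "norm (x n) \<le> norm (tt n) + \<bar>a n\<bar> / \<beta> * norm \<mu>"
      unfolding x_def using norm_triangle_ineq4[of "tt n" "(a n / \<beta>) *\<^sub>R \<mu>"] \<beta> by simp
    also have "\<dots> \<le> (1 + D) + norm v * (1 + D) / \<beta> * norm \<mu>"
      using \<beta> by (intro add_mono mult_right_mono divide_right_mono tt_bound a_bound) auto
    finally show ?thesis
      unfolding K_def
      by (intro order_trans[OF weighted_norm_le_norm[OF v0]] mult_left_mono sum_nonneg v0)
  qed

  \<comment> \<open>The total mass of the noise. Since \<open>m (Suc n)\<close> has mass 1,
    \<open>1 - z n\<close> is \<open>\<rho> n\<close> times the mass of \<open>T (th n)\<close>;
    this substitutes for a lower bound on \<open>\<rho> n\<close>.\<close>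
  define z where "z n = 1 \<bullet> f n" for n
  have gz: "summable (\<lambda>n. g n * z n)"
    using bounded_linear.summable[OF bounded_linear_inner_right gf, of 1] by (simp add: z_def)
  obtain B where B: "B > 0" "\<And>x. norm (T x) \<le> B * norm x"
    using linear_bounded_pos[OF T] by blast
  define C where "C = norm (1 :: real ^ 's) * B + 1"
  have C: "C > 0"
    using B(1) by (auto simp: C_def intro: add_nonneg_pos)
  have z_le: "1 - z n \<le> C * \<rho> n" for n
  proof -
    have "1 - z n = \<rho> n * (1 \<bullet> T (th n))"
      using arg_cong[OF m_eq[of n], of "\<lambda>x. 1 \<bullet> x"] prob_vectors_inner_1[OF m[of "Suc n"]]
      by (simp add: z_def inner_add_right)
    also have "\<dots> \<le> \<rho> n * C"
    proof (intro mult_left_mono \<rho>0)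
      have "1 \<bullet> T (th n) \<le> norm (1 :: real ^ 's) * norm (T (th n))"
        by (rule norm_cauchy_schwarz)
      also have "\<dots> \<le> norm (1 :: real ^ 's) * (B * 1)"
        using B prob_vectors_norm_le[OF th[of n]]
        by (intro mult_left_mono order_trans[OF B(2)]) auto
      finally show "1 \<bullet> T (th n) \<le> C"
        by (simp add: C_def)
    qed
    finally show ?thesis
      by (simp add: mult.commute)
  qed

  define y where "y n = weighted_norm v (x n) / \<bar>a n\<bar>" for n
  \<comment> \<open>The outer \<open>2 / \<kappa>\<close> bounds \<open>1 / a (Suc n)\<close>, and
    \<open>K * (2 / \<kappa>)\<close> bounds \<open>y n\<close>; both rest on
    \<open>\<kappa> / 2 < a n\<close> for large \<open>n\<close>.\<close>
  define h where "h n = (\<bar>v \<bullet> \<delta> n\<bar> * (K * (2 / \<kappa>)) + weighted_norm v (\<delta>' n)) * (2 / \<kappa>)" for n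
  have "y \<longlonglongrightarrow> 0"
  proof (rule perturbed_recursion_tendsto_0)
    show "0 \<le> y n" for n
      by (simp add: y_def weighted_norm_nonneg v0)
    show "0 \<le> g n" for n
      by (rule g0)
    show "g \<longlonglongrightarrow> 0" "\<not> summable g" "summable (\<lambda>n. g n * z n)"
      by fact+
    have "\<delta>' \<longlonglongrightarrow> 0 - ((v \<bullet> 0) / \<beta>) *\<^sub>R \<mu>"
      unfolding \<delta>'_def using \<beta> by (intro tendsto_intros \<delta>) auto
    then have "h \<longlonglongrightarrow> (\<bar>v \<bullet> 0\<bar> * (K * (2 / \<kappa>)) + weighted_norm v (0 - ((v \<bullet> 0) / \<beta>) *\<^sub>R \<mu>)) * (2 / \<kappa>)"
      unfolding h_def by (intro tendsto_intros \<delta> tendsto_weighted_norm)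
    then show "h \<longlonglongrightarrow> 0"
      by (simp add: weighted_norm_def)
    \<comment> \<open>The decay rate: \<open>1 + l\<close> bounds the growth factor
      \<open>\<alpha> n\<close>, and \<open>C\<close> is the price of replacing
      \<open>\<rho> n\<close> by \<open>1 - z n\<close>.\<close>
    show "0 < c / ((1 + l) * C)"
      using c C l by simp
    have "\<forall>\<^sub>F n in sequentially. \<kappa> / 2 < a (Suc n)"
      using a_low by (rule eventually_compose_filterlim) (rule filterlim_Suc)
    then show "\<forall>\<^sub>F n in sequentially.
        y (Suc n) \<le> exp (- (c / ((1 + l) * C) * g n * (1 - z n))) * y n + g n * h n"
      using a_low
    proof eventually_elim
      case (elim n)
      define N N' where "N = weighted_norm v (x n)" and "N' = weighted_norm v (x (Suc n))"
      define \<eta> where "\<eta> = weighted_norm v (\<delta>' n)"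
      define u where "u = v \<bullet> \<delta> n"
      \<comment> \<open>\<open>1 - t\<close> is the quotient of the transversal growth factor by the
        one along \<open>\<mu>\<close>.\<close>
      define t where "t = c * g n * \<rho> n / \<alpha> n"
      have a': "a n > 0" "a (Suc n) > 0"
        using elim \<kappa>(1) by linarith+
      have y_eq: "y n = N / a n" "y (Suc n) = N' / a (Suc n)"
        using a' by (simp_all add: y_def N_def N'_def)
      have y0: "0 \<le> y n"
        by (simp add: y_def weighted_norm_nonneg v0)
      have g\<rho>: "0 \<le> g n * \<rho> n"
        using g0 \<rho>0 by simp
      have \<alpha>: "0 < \<alpha> n"
        unfolding \<alpha>_def using g0 \<rho>0 l g(3)[of n] by (intro add_pos_nonneg mult_nonneg_nonneg) auto
      have "g n * \<rho> n * l \<le> 1 * 1 * l"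
        using g0 g(3)[of n] \<rho>0 \<rho>1 l by (intro mult_mono) (auto intro: less_imp_le)
      then have \<alpha>_le: "\<alpha> n \<le> 1 + l"
        using g0[of n] by (simp add: \<alpha>_def)
      have "g n * \<rho> n * c \<le> g n * \<rho> n * l"
        using c(2) g\<rho> by (rule mult_left_mono)
      then have "c * g n * \<rho> n \<le> \<alpha> n"
        using g(3)[of n] by (simp add: \<alpha>_def mult_ac)
      then have t: "0 \<le> t" "t \<le> 1"
        using \<alpha> g\<rho> c(1) by (auto simp: t_def mult.assoc)
      have "N' \<le> (\<alpha> n - c * g n * \<rho> n) * N + g n * \<eta>"
        unfolding N_def N'_def \<eta>_def by (rule x_le)
      also have "(\<alpha> n - c * g n * \<rho> n) * N = (1 - t) * y n * (\<alpha> n * a n)"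
        using \<alpha> a' by (simp add: t_def y_eq field_simps)
      \<comment> \<open>Expressed through \<open>a (Suc n)\<close>, the denominator of
        \<open>y (Suc n)\<close>; the correction \<open>g n * u\<close> is moved into
        \<open>h\<close>.\<close>
      also have "\<alpha> n * a n = a (Suc n) - g n * u"
        by (simp add: a_step u_def)
      also have "(1 - t) * y n * (a (Suc n) - g n * u) + g n * \<eta>
          \<le> (1 - t) * y n * a (Suc n) + g n * (\<bar>u\<bar> * y n) + g n * \<eta>"
      proof -
        have "(1 - t) * (y n * (g n * - u)) \<le> (1 - t) * (y n * (g n * \<bar>u\<bar>))"
          using t y0 g0[of n] by (intro mult_left_mono) auto
        also have "\<dots> \<le> y n * (g n * \<bar>u\<bar>)"
          using t y0 g0[of n] by (intro mult_left_le_one_le) auto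
        finally show ?thesis
          by (simp add: algebra_simps)
      qed
      finally have N'_le: "N' \<le> (1 - t) * y n * a (Suc n) + g n * (\<bar>u\<bar> * y n + \<eta>)"
        by (simp add: algebra_simps)
      have "y n \<le> K * (2 / \<kappa>)"
      proof -
        have "N * (\<kappa> / 2) \<le> K * a n"
          using K[of n] elim(2) \<kappa>(1) weighted_norm_nonneg[OF v0, of "x n"]
          by (intro mult_mono) (auto simp: N_def)
        then show ?thesis
          using a'(1) \<kappa>(1) by (simp add: y_eq field_simps)
      qed
      then have "\<bar>u\<bar> * y n + \<eta> \<le> \<bar>u\<bar> * (K * (2 / \<kappa>)) + \<eta>"
        by (intro add_mono mult_left_mono) auto
      moreover have "1 / a (Suc n) \<le> 2 / \<kappa>"
        using elim(1) \<kappa>(1) a'(2) by (simp add: field_simps)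
      moreover have "0 \<le> \<bar>u\<bar> * y n + \<eta>"
        using y0 by (simp add: \<eta>_def weighted_norm_nonneg v0)
      ultimately have "(\<bar>u\<bar> * y n + \<eta>) * (1 / a (Suc n)) \<le> h n"
        unfolding h_def u_def[symmetric] \<eta>_def[symmetric]
        using a'(2) by (intro mult_mono) auto
      then have "g n * ((\<bar>u\<bar> * y n + \<eta>) * (1 / a (Suc n))) \<le> g n * h n"
        using g0 by (rule mult_left_mono)
      moreover have "y (Suc n) \<le> (1 - t) * y n + g n * ((\<bar>u\<bar> * y n + \<eta>) * (1 / a (Suc n)))"
        unfolding y_eq(2) using divide_right_mono[OF N'_le, of "a (Suc n)"] a'(2)
        by (simp add: add_divide_distrib distrib_left)
      ultimately have "y (Suc n) \<le> (1 - t) * y n + g n * h n"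
        by linarith
      moreover have "1 - t \<le> exp (- (c / ((1 + l) * C) * g n * (1 - z n)))"
      proof -
        have "c / ((1 + l) * C) * g n * (1 - z n) \<le> c / ((1 + l) * C) * g n * (C * \<rho> n)"
          using c C l g0 by (intro mult_left_mono z_le) auto
        also have "\<dots> = c * g n * \<rho> n / (1 + l)"
          using C by simp
        also have "\<dots> \<le> t"
          unfolding t_def using \<alpha> \<alpha>_le c(1) g\<rho> by (intro divide_left_mono) (auto simp: mult.assoc)
        finally have "exp (- t) \<le> exp (- (c / ((1 + l) * C) * g n * (1 - z n)))"
          by simp
        then show ?thesis
          using exp_ge_add_one_self[of "- t"] by linarith
      qed
      ultimately show ?case
        using mult_right_mono[OF _ y0] by fastforce
    qed
  qed

  have "(\<lambda>n. weighted_norm v (x n)) \<longlonglongrightarrow> 0"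
  proof (rule Lim_null_comparison)
    show "\<forall>\<^sub>F n in sequentially. norm (weighted_norm v (x n)) \<le> y n * (norm v * (1 + D))"
      using a_low
    proof eventually_elim
      case (elim n)
      then have "weighted_norm v (x n) = y n * \<bar>a n\<bar>"
        using \<kappa>(1) by (simp add: y_def)
      also have "\<dots> \<le> y n * (norm v * (1 + D))"
        by (intro mult_left_mono a_bound) (simp add: y_def weighted_norm_nonneg v0)
      finally show ?case
        by (simp add: weighted_norm_nonneg v0)
    qed
    show "(\<lambda>n. y n * (norm v * (1 + D))) \<longlonglongrightarrow> 0"
      using tendsto_mult_right[OF \<open>y \<longlonglongrightarrow> 0\<close>, of "norm v * (1 + D)"] by simp
  qed
  then have "x \<longlonglongrightarrow> 0"
    by (rule weighted_norm_tendsto_0D[OF v])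
  then have "(\<lambda>n. x n - R n) \<longlonglongrightarrow> 0"
    using tendsto_diff[OF _ R] by fastforce
  then have lim: "(\<lambda>n. th n - (a n / \<beta>) *\<^sub>R \<mu>) \<longlonglongrightarrow> 0"
    by (simp add: x_def tt_def)
  \<comment> \<open>So far \<open>th\<close> only approaches the line spanned by
    \<open>\<mu>\<close>. As \<open>th n\<close> and \<open>\<mu>\<close> both have mass 1, pairing
    with the all-ones vector fixes the scalar.\<close>
  from tendsto_inner[OF tendsto_const[of 1] this]
  have "(\<lambda>n. 1 - a n / \<beta>) \<longlonglongrightarrow> 0"
    by (simp add: inner_diff_right prob_vectors_inner_1 th \<mu>)
  then have "(\<lambda>n. (th n - (a n / \<beta>) *\<^sub>R \<mu>) - (1 - a n / \<beta>) *\<^sub>R \<mu>) \<longlonglongrightarrow> 0 - 0 *\<^sub>R \<mu>"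
    by (intro tendsto_intros lim)
  then have "(\<lambda>n. th n - \<mu>) \<longlonglongrightarrow> 0"
    by (simp add: algebra_simps)
  then show ?thesis
    by (simp add: LIM_zero_iff)
qed

section \<open>Growth of the number of particles\<close>

lemma add_time_1 [simp]: "add_time \<zeta> (Suc 0) = 0"
  by (simp add: add_time_def)

lemma le_add_time:
  assumes "0 < \<zeta>" "\<zeta> < 1" "n \<ge> 2"
  shows "n \<le> add_time \<zeta> n"
proof -
  have "real n powr 1 \<le> real n powr (1 / \<zeta>)"
    using assms by (intro powr_mono) auto
  then have "real n \<le> real n powr (1 / \<zeta>)"
    using assms(3) by simp
  then show ?thesis
    using assms(3) by (simp add: add_time_def le_nat_floor)
qed

text \<open>Adding times are separated by at least one time unit, so at most one particle is added
  per step. With \<open>p = 1 / \<zeta> - 1 > 0\<close> the power is \<open>n\<close> times the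
  increasing factor \<open>n powr p\<close>, which is at least 1, so raising \<open>n\<close> by one
  raises the power by at least 1.\<close>

lemma add_time_strict:
  assumes \<zeta>: "0 < \<zeta>" "\<zeta> < 1" and n: "n \<ge> 1"
  shows "add_time \<zeta> n + 1 \<le> add_time \<zeta> (n + 1)"
proof (cases "n = 1")
  case True
  \<comment> \<open>The value at 1 is 0 by convention and not the floor of the power, so this case
    uses the bound at 2 instead.\<close>
  then show ?thesis
    using le_add_time[OF \<zeta>, of 2] by (simp add: numeral_2_eq_2)
next
  case False
  define p where "p = 1 / \<zeta> - 1"
  have p: "p > 0"
    using \<zeta> by (simp add: p_def)
  have powr_p: "real k powr (1 / \<zeta>) = real k * real k powr p" if "k \<ge> 1" for k
    using that powr_add[of "real k" 1 p] by (simp add: p_def)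
  have "real n powr (1 / \<zeta>) + 1 \<le> real n * real (n + 1) powr p + real (n + 1) powr p"
  proof (rule add_mono)
    show "real n powr (1 / \<zeta>) \<le> real n * real (n + 1) powr p"
      unfolding powr_p[OF n] using p n by (intro mult_left_mono powr_mono2) auto
    show "1 \<le> real (n + 1) powr p"
      using p n by (intro ge_one_powr_ge_zero) auto
  qed
  also have "\<dots> = real (n + 1) powr (1 / \<zeta>)"
    by (subst powr_p) (simp_all add: algebra_simps)
  finally have "\<lfloor>real n powr (1 / \<zeta>)\<rfloor> + 1 \<le> \<lfloor>real (n + 1) powr (1 / \<zeta>)\<rfloor>"
    by linarith
  moreover have "0 \<le> \<lfloor>real n powr (1 / \<zeta>)\<rfloor>"
    by simp
  ultimately have "nat \<lfloor>real n powr (1 / \<zeta>)\<rfloor> + 1 \<le> nat \<lfloor>real (n + 1) powr (1 / \<zeta>)\<rfloor>"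
    by linarith
  then show ?thesis
    using False n by (simp only: add_time_def) simp
qed

context
  fixes \<zeta> :: real
  assumes \<zeta>: "0 < \<zeta>" "\<zeta> < 1"
begin

text \<open>Makes the \<open>Max\<close> in \<open>num_particles\<close> one of a finite set.
  Indices from 2 on are at most \<open>k\<close>; the extra 1 in the bound accounts for the index 1
  when \<open>k = 0\<close>.\<close>

lemma add_times_bounded: "{n. n \<ge> 1 \<and> add_time \<zeta> n \<le> k} \<subseteq> {1..k + 1}"
proof
  fix n assume n: "n \<in> {n. n \<ge> 1 \<and> add_time \<zeta> n \<le> k}"
  show "n \<in> {1..k + 1}"
  proof (cases "n = 1")
    case False
    with n le_add_time[OF \<zeta>, of n] show ?thesis
      by auto
  qed simp
qed

lemma finite_add_times: "finite {n. n \<ge> 1 \<and> add_time \<zeta> n \<le> k}"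
  using add_times_bounded by (rule finite_subset) simp

lemma one_in_add_times: "1 \<in> {n. n \<ge> 1 \<and> add_time \<zeta> n \<le> k}"
  by (simp add: add_time_def)

lemma num_particles_in: "num_particles \<zeta> k \<in> {n. n \<ge> 1 \<and> add_time \<zeta> n \<le> k}"
  unfolding num_particles_def using finite_add_times one_in_add_times by (intro Max_in) blast+

lemma num_particles_ge_1: "1 \<le> num_particles \<zeta> k"
  using num_particles_in by simp

lemma num_particles_le: "num_particles \<zeta> k \<le> k + 1"
  using subsetD[OF add_times_bounded num_particles_in] by simp

lemma num_particles_geI: "1 \<le> n \<Longrightarrow> add_time \<zeta> n \<le> k \<Longrightarrow> n \<le> num_particles \<zeta> k"
  unfolding num_particles_def using finite_add_times by (intro Max_ge) simp_all

lemma num_particles_le_Suc: "num_particles \<zeta> k \<le> num_particles \<zeta> (k + 1)"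
  using num_particles_in[of k] by (intro num_particles_geI[OF num_particles_ge_1]) auto

lemma num_particles_Suc_le: "num_particles \<zeta> (k + 1) \<le> num_particles \<zeta> k + 1"
proof (cases "num_particles \<zeta> (k + 1) = 1")
  case False
  define n where "n = num_particles \<zeta> (k + 1) - 1"
  with False have n: "num_particles \<zeta> (k + 1) = n + 1" "n \<ge> 1"
    using num_particles_ge_1[of "k + 1"] by linarith+
  have "add_time \<zeta> (n + 1) \<le> k + 1"
    using num_particles_in[of "k + 1"] n(1) by simp
  then have "add_time \<zeta> n \<le> k"
    using add_time_strict[OF \<zeta> n(2)] by simp
  then show ?thesis
    using num_particles_geI[of n k] n by simp
qed simp

end

section \<open>Series of martingale differences\<close>

text \<open>Between consecutive cubes there are of order \<open>j ^ 2\<close> steps, each at most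
  \<open>C / j ^ 3\<close>, so the sequence varies by O(1/j) inside a block.\<close>

lemma tendsto_of_cube_subsequence:
  fixes X :: "nat \<Rightarrow> real"
  assumes sub: "(\<lambda>j. X (j ^ 3)) \<longlonglongrightarrow> L"
    and inc: "\<And>n. \<bar>X (Suc n) - X n\<bar> \<le> C / real (n + 1)"
  shows "X \<longlonglongrightarrow> L"
proof -
  have C: "C \<ge> 0"
    using inc[of 0] by simp
  \<comment> \<open>\<open>r n ^ 3\<close> is the largest cube not exceeding
    \<open>n\<close>.\<close>
  define r where "r n = nat \<lfloor>root 3 (real n)\<rfloor>" for n
  have r_le: "r n ^ 3 \<le> n" for n
  proof -
    have "real (r n) ^ 3 \<le> root 3 (real n) ^ 3"
      by (intro power_mono) (auto simp: r_def)
    then have "real (r n ^ 3) \<le> real n"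
      by simp
    then show ?thesis
      by (simp only: of_nat_le_iff)
  qed
  have r_gt: "n < (r n + 1) ^ 3" for n
  proof -
    have "root 3 (real n) < real (r n + 1)"
      unfolding r_def by (simp add: nat_add_distrib) linarith
    then have "root 3 (real n) ^ 3 < real (r n + 1) ^ 3"
      by (intro power_strict_mono) auto
    then have "real n < real ((r n + 1) ^ 3)"
      by simp
    then show ?thesis
      by (simp only: of_nat_less_iff)
  qed
  have r_lim: "filterlim r at_top sequentially"
    unfolding filterlim_at_top eventually_sequentially
  proof (intro allI)
    fix Z
    have "Z \<le> r n" if "n \<ge> Z ^ 3" for n
    proof (rule ccontr)
      assume "\<not> Z \<le> r n"
      then have "(r n + 1) ^ 3 \<le> Z ^ 3"
        by (intro power_mono) auto
      with r_gt[of n] that show False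
        by linarith
    qed
    then show "\<exists>N. \<forall>n\<ge>N. Z \<le> r n"
      by blast
  qed
  have incs: "\<bar>X (m + k) - X m\<bar> \<le> real k * (C / real (m + 1))" for m k
  proof (induction k)
    case (Suc k)
    have "\<bar>X (m + Suc k) - X m\<bar> \<le> \<bar>X (Suc (m + k)) - X (m + k)\<bar> + \<bar>X (m + k) - X m\<bar>"
      by simp
    also have "\<dots> \<le> C / real (m + 1) + real k * (C / real (m + 1))"
    proof (rule add_mono[OF order_trans[OF inc] Suc])
      show "C / real (m + k + 1) \<le> C / real (m + 1)"
        using C by (intro divide_left_mono) auto
    qed
    finally show ?case
      by (simp add: algebra_simps add_divide_distrib)
  qed simp
  have bound: "\<bar>X n - X (r n ^ 3)\<bar> \<le> 6 * C / real (r n)" if "1 \<le> r n" for n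
  proof -
    define j where "j = r n"
    have j: "j ^ 3 \<le> n" "n < (j + 1) ^ 3" "1 \<le> j"
      using r_le r_gt that by (auto simp: j_def)
    have "j \<le> j * j"
      using j(3) by simp
    moreover have "(j + 1) ^ 3 = j ^ 3 + 3 * (j * j) + 3 * j + 1"
      by (simp add: power3_eq_cube algebra_simps)
    ultimately have "n - j ^ 3 \<le> 6 * (j * j)"
      using j by linarith
    then have "real (n - j ^ 3) \<le> real (6 * (j * j))"
      by (simp only: of_nat_le_iff)
    then have k: "real (n - j ^ 3) \<le> 6 * (real j * real j)"
      by (simp only: of_nat_mult of_nat_numeral)
    have "\<bar>X n - X (j ^ 3)\<bar> \<le> real (n - j ^ 3) * (C / real (j ^ 3 + 1))"
      using incs[of "j ^ 3" "n - j ^ 3"] j(1) by simp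
    also have "\<dots> \<le> 6 * (real j * real j) * (C / real (j ^ 3))"
      using C j(3) k by (intro mult_mono divide_left_mono) (auto intro!: mult_pos_pos add_pos_nonneg)
    also have "\<dots> = 6 * C / real j"
      using j(3) by (simp add: power3_eq_cube field_simps)
    finally show ?thesis
      by (simp add: j_def)
  qed
  have "(\<lambda>n. X n - X (r n ^ 3)) \<longlonglongrightarrow> 0"
  proof (rule Lim_null_comparison)
    have "\<forall>\<^sub>F n in sequentially. 1 \<le> r n"
      using r_lim by (auto simp: filterlim_at_top)
    then show "\<forall>\<^sub>F n in sequentially. norm (X n - X (r n ^ 3)) \<le> 6 * C / real (r n)"
      by eventually_elim (simp add: bound)
    show "(\<lambda>n. 6 * C / real (r n)) \<longlonglongrightarrow> 0"
      by (rule filterlim_compose[OF lim_const_over_n r_lim])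
  qed
  then have "(\<lambda>n. (X n - X (r n ^ 3)) + X (r n ^ 3)) \<longlonglongrightarrow> 0 + L"
    by (intro tendsto_add filterlim_compose[OF sub r_lim])
  then show ?thesis
    by simp
qed

text \<open>
  The partial sums converge along the cubes because the \<open>L\<^sup>1\<close>-norms of the blocks between
  consecutive cubes are summable by orthogonality; the increments are too small to
  matter inside a block. This makes Doob's maximal inequality unnecessary.
\<close>

lemma (in prob_space) martingale_difference_series_summable:
  fixes D :: "nat \<Rightarrow> 'a \<Rightarrow> real" and F :: "nat \<Rightarrow> 'a measure" and g :: "nat \<Rightarrow> real"
  assumes F: "\<And>n. subalgebra M (F n)" and F_mono: "\<And>n. subalgebra (F (Suc n)) (F n)"
    and D_meas: "\<And>n. D n \<in> borel_measurable (F (Suc n))"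
    and D_bound: "\<And>n. AE w in M. \<bar>D n w\<bar> \<le> B"
    and D_cond: "\<And>n. AE w in M. real_cond_exp M (F n) (D n) w = 0"
    and g: "\<And>n. 0 \<le> g n" "\<And>n. g n \<le> C / real (n + 1)"
  shows "AE w in M. summable (\<lambda>n. g n * D n w)"
proof -
  have B: "B \<ge> 0"
  proof -
    have "AE w in M. 0 \<le> B"
      using D_bound[of 0] by eventually_elim simp
    then show ?thesis
      by simp
  qed
  have C: "C \<ge> 0"
    using g[of 0] by simp
  have F_le: "subalgebra (F n) (F m)" if "m \<le> n" for m n
    using that
  proof (induction n rule: dec_induct)
    case base
    then show ?case by (simp add: subalgebra_def)
  next
    case (step n)
    then show ?case using F_mono[of n] by (auto simp: subalgebra_def)
  qed
  have DM[measurable]: "D n \<in> borel_measurable M" for n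
    using measurable_from_subalg[OF F D_meas] .
  define S where "S p n w = (\<Sum>k=p..<n. g k * D k w)" for p n w
  have S_meas: "S p n \<in> borel_measurable (F n)" for p n
    unfolding S_def
    by (intro borel_measurable_sum borel_measurable_times borel_measurable_const
        measurable_from_subalg[OF F_le D_meas]) auto
  have SM[measurable]: "S p n \<in> borel_measurable M" for p n
    by (rule measurable_from_subalg[OF F S_meas])
  have all_D: "AE w in M. \<forall>n. \<bar>D n w\<bar> \<le> B"
    using D_bound by (simp add: AE_all_countable)
  then have S_bound: "AE w in M. \<bar>S p n w\<bar> \<le> (\<Sum>k=p..<n. g k * B)" for p n
  proof eventually_elim
    case (elim w)
    have "\<bar>S p n w\<bar> \<le> (\<Sum>k=p..<n. \<bar>g k * D k w\<bar>)"
      unfolding S_def by (rule sum_abs)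
    also have "\<dots> \<le> (\<Sum>k=p..<n. g k * B)"
      using elim g(1) by (intro sum_mono) (auto simp: abs_mult mult_left_mono)
    finally show ?case .
  qed
  have int_mult: "integrable M (\<lambda>w. U w * V w)"
    if "U \<in> borel_measurable M" "V \<in> borel_measurable M"
      "AE w in M. \<bar>U w\<bar> \<le> b" "AE w in M. \<bar>V w\<bar> \<le> b'" for U V :: "'a \<Rightarrow> real" and b b'
  proof (rule integrable_const_bound)
    show "AE w in M. norm (U w * V w) \<le> b * b'"
      using that(3,4) by eventually_elim (auto simp: abs_mult intro: mult_mono)
    show "(\<lambda>w. U w * V w) \<in> borel_measurable M"
      using that by measurable
  qed
  \<comment> \<open>\<open>S p n\<close> is measurable for \<open>F n\<close>, so \<open>D n\<close>
    may be replaced under the integral by its conditional expectation 0. Boundedness of both factors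
    supplies integrability.\<close>
  have orth: "(\<integral>w. S p n w * D n w \<partial>M) = 0" for p n
  proof -
    interpret F: finite_measure_subalgebra M "F n"
      by unfold_locales (rule F)
    have "(\<integral>w. S p n w * D n w \<partial>M) = (\<integral>w. S p n w * real_cond_exp M (F n) (D n) w \<partial>M)"
      by (rule F.real_cond_exp_intg(2)[symmetric])
        (use S_meas int_mult[OF SM DM S_bound D_bound] in auto)
    also have "\<dots> = (\<integral>w. 0 \<partial>M)"
      by (rule integral_cong_AE) (use D_cond[of n] in auto)
    finally show ?thesis
      by simp
  qed
  have S_int: "integrable M (\<lambda>w. (S p n w)\<^sup>2)" for p n
    using int_mult[OF SM SM S_bound S_bound] by (simp add: power2_eq_square)
  have S_sq: "(\<integral>w. (S p n w)\<^sup>2 \<partial>M) \<le> B\<^sup>2 * (\<Sum>k=p..<n. (g k)\<^sup>2)" if "p \<le> n" for p n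
    using that
  proof (induction n rule: dec_induct)
    case base
    then show ?case by (simp add: S_def)
  next
    case (step n)
    have S_Suc: "S p (Suc n) w = S p n w + g n * D n w" for w
      using step.hyps by (simp add: S_def)
    have "(\<integral>w. (S p (Suc n) w)\<^sup>2 \<partial>M)
        = (\<integral>w. (S p n w)\<^sup>2 + (2 * g n * (S p n w * D n w) + (g n)\<^sup>2 * (D n w * D n w)) \<partial>M)"
      by (simp add: S_Suc power2_eq_square algebra_simps)
    also have "\<dots> = (\<integral>w. (S p n w)\<^sup>2 \<partial>M) + (2 * g n * (\<integral>w. S p n w * D n w \<partial>M)
        + (g n)\<^sup>2 * (\<integral>w. D n w * D n w \<partial>M))"
      using S_int int_mult[OF SM DM S_bound D_bound] int_mult[OF DM DM D_bound D_bound]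
      by simp
    also have "(\<integral>w. D n w * D n w \<partial>M) \<le> (\<integral>w. B\<^sup>2 \<partial>M)"
    proof (rule integral_mono_AE)
      show "AE w in M. D n w * D n w \<le> B\<^sup>2"
        using D_bound[of n]
      proof eventually_elim
        case (elim w)
        then have "\<bar>D n w\<bar> * \<bar>D n w\<bar> \<le> B * B"
          by (intro mult_mono) auto
        then show ?case
          by (simp add: power2_eq_square flip: abs_mult)
      qed
    qed (use int_mult[OF DM DM D_bound D_bound] in auto)
    finally have "(\<integral>w. (S p (Suc n) w)\<^sup>2 \<partial>M) \<le> (\<integral>w. (S p n w)\<^sup>2 \<partial>M) + (g n)\<^sup>2 * B\<^sup>2"
      by (simp add: orth prob_space mult_left_mono)
    with step show ?case
      by (simp add: algebra_simps)
  qed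
  \<comment> \<open>A block has of order \<open>j ^ 2\<close> terms with squared weights of order
    \<open>j ^ -6\<close>. Its second moment is thus of order \<open>j ^ -4\<close>, which suggests
    an expected absolute value of order \<open>j ^ -2\<close>.\<close>
  define V where "V j = S (j ^ 3) ((j + 1) ^ 3)" for j :: nat
  have block: "(\<Sum>k=j ^ 3..<(j + 1) ^ 3. (g k)\<^sup>2) \<le> 7 * C\<^sup>2 / real j ^ 4" if "j \<ge> 1" for j
  proof -
    have "(\<Sum>k=j ^ 3..<(j + 1) ^ 3. (g k)\<^sup>2) \<le> (\<Sum>k=j ^ 3..<(j + 1) ^ 3. (C / real (j ^ 3))\<^sup>2)"
    proof (intro sum_mono power_mono g(1))
      fix k assume k: "k \<in> {j ^ 3..<(j + 1) ^ 3}"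
      have "g k \<le> C / real (k + 1)"
        by (rule g)
      also have "\<dots> \<le> C / real (j ^ 3)"
        using k C that by (intro divide_left_mono) (auto simp del: of_nat_power)
      finally show "g k \<le> C / real (j ^ 3)" .
    qed
    also have "\<dots> = real ((j + 1) ^ 3 - j ^ 3) * (C / real (j ^ 3))\<^sup>2"
      by simp
    also have "\<dots> \<le> (7 * (real j * real j)) * (C / real (j ^ 3))\<^sup>2"
    proof (intro mult_right_mono)
      have "j \<le> j * j" "1 \<le> j * j"
        using that by auto
      moreover have "(j + 1) ^ 3 = j ^ 3 + 3 * (j * j) + 3 * j + 1"
        by (simp add: power3_eq_cube algebra_simps)
      ultimately have "(j + 1) ^ 3 - j ^ 3 \<le> 7 * (j * j)"
        by linarith
      then have "real ((j + 1) ^ 3 - j ^ 3) \<le> real (7 * (j * j))"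
        by (simp only: of_nat_le_iff)
      then show "real ((j + 1) ^ 3 - j ^ 3) \<le> 7 * (real j * real j)"
        by (simp only: of_nat_mult of_nat_numeral)
    qed simp
    also have "\<dots> = 7 * C\<^sup>2 / real j ^ 4"
      using that by (simp add: power2_eq_square power3_eq_cube power4_eq_xxxx field_simps)
    finally show ?thesis .
  qed
  \<comment> \<open>From the arithmetic-geometric mean inequality
    \<open>2 * \<bar>V\<bar> \<le> j ^ 2 * V ^ 2 + 1 / j ^ 2\<close>, used in place of
    Cauchy-Schwarz: the block bound yields the first summand, the free term the 1. It needs
    \<open>j \<ge> 1\<close>, hence the shift to \<open>Suc j\<close> in the series below.\<close>
  define c where "c = (B\<^sup>2 * (7 * C\<^sup>2) + 1) / 2"
  have V_int: "integrable M (\<lambda>w. \<bar>V j w\<bar>)" for j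
  proof (rule integrable_const_bound)
    show "AE w in M. norm \<bar>V j w\<bar> \<le> (\<Sum>k=j ^ 3..<(j + 1) ^ 3. g k * B)"
      using S_bound by (simp add: V_def)
  qed (simp add: V_def)
  have V_bound: "(\<integral>w. \<bar>V j w\<bar> \<partial>M) \<le> c * inverse (real j ^ 2)" if j: "j \<ge> 1" for j
  proof -
    have "(\<integral>w. \<bar>V j w\<bar> \<partial>M) \<le> (\<integral>w. (real j ^ 2 * (V j w)\<^sup>2 + inverse (real j ^ 2)) / 2 \<partial>M)"
    proof (rule integral_mono)
      show "integrable M (\<lambda>w. (real j ^ 2 * (V j w)\<^sup>2 + inverse (real j ^ 2)) / 2)"
        using S_int by (simp add: V_def)
      fix w
      have "0 \<le> (real j * \<bar>V j w\<bar> - inverse (real j))\<^sup>2"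
        by simp
      also have "\<dots> = real j ^ 2 * (V j w)\<^sup>2 + inverse (real j ^ 2) - 2 * \<bar>V j w\<bar>"
        using j by (simp add: power2_diff power_mult_distrib power_inverse)
      finally show "\<bar>V j w\<bar> \<le> (real j ^ 2 * (V j w)\<^sup>2 + inverse (real j ^ 2)) / 2"
        by simp
    qed (rule V_int)
    also have "\<dots> = (real j ^ 2 * (\<integral>w. (V j w)\<^sup>2 \<partial>M) + inverse (real j ^ 2)) / 2"
      using S_int by (simp add: V_def prob_space)
    also have "\<dots> \<le> (real j ^ 2 * (B\<^sup>2 * (7 * C\<^sup>2 / real j ^ 4)) + inverse (real j ^ 2)) / 2"
    proof -
      have "(\<integral>w. (V j w)\<^sup>2 \<partial>M) \<le> B\<^sup>2 * (\<Sum>k=j ^ 3..<(j + 1) ^ 3. (g k)\<^sup>2)"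
        unfolding V_def by (intro S_sq power_mono) auto
      also have "\<dots> \<le> B\<^sup>2 * (7 * C\<^sup>2 / real j ^ 4)"
        by (intro mult_left_mono block j) auto
      finally show ?thesis
        by (intro divide_right_mono add_mono mult_left_mono) auto
    qed
    also have "\<dots> = c * inverse (real j ^ 2)"
      using j by (simp add: c_def power2_eq_square power4_eq_xxxx field_simps)
    finally show ?thesis .
  qed
  have "AE w in M. (\<Sum>j. ennreal \<bar>V (Suc j) w\<bar>) \<noteq> \<infinity>"
  proof (rule nn_integral_PInf_AE)
    show "(\<lambda>w. \<Sum>j. ennreal \<bar>V (Suc j) w\<bar>) \<in> borel_measurable M"
      unfolding V_def by measurable
    have "(\<integral>\<^sup>+ w. (\<Sum>j. ennreal \<bar>V (Suc j) w\<bar>) \<partial>M) = (\<Sum>j. \<integral>\<^sup>+ w. ennreal \<bar>V (Suc j) w\<bar> \<partial>M)"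
      by (rule nn_integral_suminf) (simp add: V_def)
    also have "\<dots> = (\<Sum>j. ennreal (\<integral>w. \<bar>V (Suc j) w\<bar> \<partial>M))"
      by (intro suminf_cong nn_integral_eq_integral V_int) auto
    also have "\<dots> \<le> (\<Sum>j. ennreal (c * inverse (real (Suc j) ^ 2)))"
      by (intro suminf_le ennreal_leI V_bound) auto
    also have "\<dots> < \<infinity>"
    proof -
      have "summable (\<lambda>j. c * inverse (real (Suc j) ^ 2))"
        using inverse_power_summable[of 2, where 'a = real]
          summable_Suc_iff[of "\<lambda>j. inverse (real j ^ 2)"] by (intro summable_mult) simp
      moreover have "c \<ge> 0"
        by (simp add: c_def)
      ultimately show ?thesis
        by (subst suminf_ennreal2) auto
    qed
    finally show "(\<integral>\<^sup>+ w. (\<Sum>j. ennreal \<bar>V (Suc j) w\<bar>) \<partial>M) \<noteq> \<infinity>"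
      by simp
  qed
  then show ?thesis
    using all_D
  proof eventually_elim
    case (elim w)
    have "summable (\<lambda>j. \<bar>V (Suc j) w\<bar>)"
      using elim(1) by (intro summable_suminf_not_top) auto
    then have "summable (\<lambda>j. V (Suc j) w)"
      by (rule summable_rabs_cancel)
    then have sV: "summable (\<lambda>j. V j w)"
      using summable_Suc_iff[of "\<lambda>j. V j w"] by blast
    have V_sum: "(\<Sum>i<j. V i w) = S 0 (j ^ 3) w" for j
    proof (induction j)
      case (Suc j)
      have "S 0 (j ^ 3) w + S (j ^ 3) ((j + 1) ^ 3) w = S 0 ((j + 1) ^ 3) w"
        unfolding S_def by (intro sum.atLeastLessThan_concat power_mono) auto
      with Suc show ?case
        by (simp add: V_def)
    qed (simp add: S_def)
    have "(\<lambda>j. S 0 (j ^ 3) w) \<longlonglongrightarrow> (\<Sum>j. V j w)"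
      using summable_LIMSEQ[OF sV] by (simp add: V_sum)
    then have "(\<lambda>n. S 0 n w) \<longlonglongrightarrow> (\<Sum>j. V j w)"
    proof (rule tendsto_of_cube_subsequence)
      fix n
      have "\<bar>S 0 (Suc n) w - S 0 n w\<bar> = g n * \<bar>D n w\<bar>"
        using g(1) by (simp add: S_def abs_mult)
      also have "\<dots> \<le> C / real (n + 1) * B"
        using elim(2) g C by (intro mult_mono) auto
      finally show "\<bar>S 0 (Suc n) w - S 0 n w\<bar> \<le> C * B / real (n + 1)"
        by simp
    qed
    then have "convergent (\<lambda>n. \<Sum>i<n. g i * D i w)"
      unfolding S_def convergent_def lessThan_atLeast0 by blast
    then show ?case
      by (simp add: summable_iff_convergent)
  qed
qed

section \<open>The empirical measures of the particles\<close>

lemma sets_join_algebra: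
  assumes "space A = space B"
  shows "sets A \<subseteq> sets (join_algebra A B)" "sets B \<subseteq> sets (join_algebra A B)"
proof -
  have "sets A \<union> sets B \<subseteq> Pow (space A)"
    using assms sets.sets_into_space by blast
  then have "sets A \<union> sets B \<subseteq> sets (join_algebra A B)"
    unfolding join_algebra_def by (simp add: sets_measure_of sigma_sets_superset_generator)
  then show "sets A \<subseteq> sets (join_algebra A B)" "sets B \<subseteq> sets (join_algebra A B)"
    by auto
qed

lemma vimage_in_gen_algebra:
  assumes "i \<in> I"
  shows "X i -` S \<inter> \<Omega> \<in> sets (gen_algebra \<Omega> I X)"
proof -
  let ?V = "\<lambda>i. vimage_algebra \<Omega> (X i) (count_space UNIV)"
  have "sets (?V i) \<subseteq> Pow \<Omega>" for i
    using sets.sets_into_space[of _ "?V i"] by auto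
  then have "(\<Union>i\<in>I. sets (?V i)) \<subseteq> sets (gen_algebra \<Omega> I X)"
    unfolding gen_algebra_def by (subst sets_measure_of) (auto intro!: sigma_sets.Basic)
  moreover have "X i -` S \<inter> \<Omega> \<in> sets (?V i)"
    by (rule in_vimage_algebra) simp
  ultimately show ?thesis
    using assms by blast
qed

definition empirical :: "nat \<Rightarrow> (nat \<Rightarrow> 's) \<Rightarrow> real ^ 's::finite" where
  "empirical k x = (1 / real k) *\<^sub>R (\<Sum>i = 1..k. dirac (x i))"

lemma empirical_nth: "empirical k x $ y = (1 / real k) * (\<Sum>i = 1..k. if x i = y then 1 else 0)"
proof -
  have "dirac (x i) $ y = (if x i = y then 1 else 0)" for i
    by (auto simp: axis_def)
  then show ?thesis
    by (simp add: empirical_def)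
qed

lemma dirac_prob_vectors: "dirac x \<in> prob_vectors"
  by (simp add: prob_vectors_def axis_def)

lemma empirical_prob_vectors:
  assumes "1 \<le> k"
  shows "empirical k x \<in> prob_vectors"
proof -
  have "(\<Sum>y\<in>UNIV. empirical k x $ y) = (1 / real k) * (\<Sum>i = 1..k. \<Sum>y\<in>UNIV. if x i = y then 1 else 0)"
    unfolding empirical_nth sum_distrib_left[symmetric] by (subst sum.swap) simp
  then show ?thesis
    using assms by (simp add: prob_vectors_def empirical_nth sum_nonneg)
qed

text \<open>A new point moves the mean by \<open>1 / (k + 1)\<close> times its difference from the
  old mean, and both have norm at most 1.\<close>

lemma norm_empirical_Suc:
  assumes "1 \<le> k"
  shows "norm (empirical (k + 1) x - empirical k x) \<le> 2 / real (k + 1)"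
proof -
  define c where "c = real (k + 1)"
  have c: "c \<noteq> 0"
    by (simp add: c_def)
  have "(c - 1) *\<^sub>R empirical k x = (\<Sum>i = 1..k. dirac (x i))"
    using assms by (simp add: empirical_def c_def)
  then have "empirical (k + 1) x = (1 / c) *\<^sub>R ((c - 1) *\<^sub>R empirical k x + dirac (x (k + 1)))"
    by (simp add: empirical_def[of "Suc k"] c_def)
  then have "empirical (k + 1) x - empirical k x = (1 / c) *\<^sub>R (dirac (x (k + 1)) - empirical k x)"
    using c by (simp add: algebra_simps diff_divide_distrib)
  also have "norm \<dots> \<le> (1 / real (k + 1)) * (1 + 1)"
    unfolding norm_scaleR c_def
    using norm_triangle_ineq4[of "dirac (x (k + 1))" "empirical k x"]
      prob_vectors_norm_le[OF dirac_prob_vectors[of "x (k + 1)"]]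
      prob_vectors_norm_le[OF empirical_prob_vectors[OF assms, of x]]
    by (intro mult_mono) auto
  finally show ?thesis
    by simp
qed

text \<open>Applied with \<open>k = n + 1\<close> for the martingale part and with
  \<open>k = a n\<close> for the added particles.\<close>

lemma step_size_le:
  assumes "0 \<le> gs" "1 \<le> k" "k \<le> n + 1"
  shows "step_size gs (Suc n) \<le> gs / real k"
proof -
  have "real k \<le> real (n + N_star gs)"
    using assms by (simp only: of_nat_le_iff N_star_def)
  then show ?thesis
    using assms by (auto intro!: divide_left_mono)
qed

definition exit_vec :: "real ^ ('s::finite option) ^ ('s option) \<Rightarrow> real ^ 's" where
  "exit_vec P = (\<chi> x. P $ Some x $ None)"

text \<open>The rank-one structure of \<open>K\<close> survives averaging over particles:
  \<open>\<nu>\<close> enters only multiplied by the scalar exit mass.\<close>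

lemma empirical_K:
  "(1 / real k) * (\<Sum>i = 1..k. K P \<nu> $ x i $ y)
    = killed_step P (empirical k x) $ y + (exit_vec P \<bullet> empirical k x) * \<nu> $ y"
proof -
  have "killed_step P (dirac z) $ y = P $ Some z $ Some y" for z
    by (simp add: killed_step_def axis_def if_distrib[where f = "\<lambda>t. t * _"] cong: if_cong)
  then have 1: "killed_step P (empirical k x) $ y = (1 / real k) * (\<Sum>i = 1..k. P $ Some (x i) $ Some y)"
    by (simp add: empirical_def linear_scale[OF linear_killed_step] linear_sum[OF linear_killed_step])
  have 2: "exit_vec P \<bullet> empirical k x = (1 / real k) * (\<Sum>i = 1..k. P $ Some (x i) $ None)"
    by (simp add: empirical_def inner_sum_right inner_axis exit_vec_def)
  show ?thesis
    unfolding 1 2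
    by (simp add: K_def sum.distrib sum_distrib_right algebra_simps add_divide_distrib)
      (simp add: sum_distrib_left)
qed

lemma sum_K_row:
  assumes "stochastic_matrix P" "\<nu> \<in> prob_vectors"
  shows "(\<Sum>y\<in>UNIV. K P \<nu> $ x $ y) = 1"
  using assms stochastic_matrix_killed_row[OF assms(1), of x]
  by (simp add: K_def sum.distrib prob_vectors_def flip: sum_distrib_left)

lemma summable_vecI:
  fixes f :: "nat \<Rightarrow> real ^ 's::finite"
  assumes "\<And>i. summable (\<lambda>n. f n $ i)"
  shows "summable f"
proof -
  have "f n = (\<Sum>i\<in>UNIV. f n $ i *\<^sub>R axis i 1)" for n
    using basis_expansion[of "f n"] by (simp add: scalar_mult_eq_scaleR)
  moreover have "summable (\<lambda>n. \<Sum>i\<in>UNIV. f n $ i *\<^sub>R (axis i 1 :: real ^ 's))"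
    by (intro summable_sum summable_scaleR_left assms)
  ultimately show ?thesis
    by presburger
qed

section \<open>The filtration of the algorithm\<close>

context algorithm_II
begin

lemma space_F [simp]: "space (F n) = space M"
  using F_sub[of n] by (simp add: subalgebra_def)

lemma sets_G_subset: "sets (G (n + 1)) \<subseteq> sets (F (n + 1))"
  unfolding F_step
  by (rule sets_join_algebra) (use G_sub[of n] in \<open>simp add: subalgebra_def\<close>)

lemma sets_F_subset_G: "sets (F n) \<subseteq> sets (G (n + 1))"
  and sets_gen_subset_G: "sets (gen_algebra (space M) {1..a (n + 2)} (X (n + 1))) \<subseteq> sets (G (n + 1))"
  unfolding G_step by (rule sets_join_algebra; simp add: gen_algebra_def space_measure_of_conv)+

lemma subalgebra_F_Suc: "subalgebra (F (Suc n)) (F n)"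
  using sets_F_subset_G[of n] sets_G_subset[of n] by (auto simp: subalgebra_def)

lemma X_measurable_F:
  assumes "i \<in> {1..a (n + 2)}"
  shows "X (n + 1) i \<in> measurable (F (n + 1)) (count_space UNIV)"
proof (rule measurableI)
  fix A
  have "X (n + 1) i -` A \<inter> space M \<in> sets (gen_algebra (space M) {1..a (n + 2)} (X (n + 1)))"
    using assms by (rule vimage_in_gen_algebra)
  then show "X (n + 1) i -` A \<inter> space (F (n + 1)) \<in> sets (F (n + 1))"
    using sets_gen_subset_G[of n] sets_G_subset[of n] by auto
qed simp

lemma F_subalgebra: "finite_measure_subalgebra M (F n)"
  by unfold_locales (rule F_sub)

end

section \<open>Conditional laws of the particles and convergence of the noise series\<close>

locale algorithm_II_stochastic = algorithm_II +
  assumes P_stochastic: "stochastic_matrix P" and zeta: "0 < \<zeta>" "\<zeta> < 1" and gs_pos: "0 < gs"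
begin

lemma a_ge_1: "1 \<le> a n"
  and a_le: "a n \<le> n + 1"
  and a_le_Suc: "a n \<le> a (n + 1)"
  and a_Suc_le: "a (n + 1) \<le> a n + 1"
  unfolding a_def
  by (simp_all only: num_particles_ge_1[OF zeta] num_particles_le[OF zeta]
      num_particles_le_Suc[OF zeta] num_particles_Suc_le[OF zeta])

text \<open>An added particle is one more particle that moves from the position of its parent.
  Extending the list of starting points by that entry gives both cases the same product over
  \<open>a (n + 2)\<close> factors; the entry depends on the outcome, hence the existential
  quantifier.\<close>

lemma joint_transition:
  "AE w in M. \<exists>x. (\<forall>j\<in>{1..a (n + 1)}. x j = X n j w) \<and>
     (\<forall>f\<in>{1..a (n + 2)} \<rightarrow>\<^sub>E UNIV.
        real_cond_exp M (F n) (indicator {v \<in> space M. \<forall>i\<in>{1..a (n + 2)}. X (n + 1) i v = f i}) w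
        = (\<Prod>j = 1..a (n + 2). K P (\<theta> n w) $ x j $ f j))"
proof -
  let ?N = "a (n + 1)"
  let ?E = "\<lambda>f. indicator {v \<in> space M. \<forall>i\<in>{1..a (n + 2)}. X (n + 1) i v = f i} :: 'a \<Rightarrow> real"
  consider "a (n + 2) = ?N" | "a (n + 2) = ?N + 1"
    using a_le_Suc[of "n + 1"] a_Suc_le[of "n + 1"] by (fastforce simp: numeral_2_eq_2)
  then show ?thesis
  proof cases
    case 1
    \<comment> \<open>The exceptional set depends on \<open>x\<close> and \<open>f\<close>.
      Restricting to extensional functions leaves finitely many of them, so the exceptional sets can
      be united before the actual positions are inserted.\<close>
    have "AE w in M. \<forall>x\<in>{1..?N} \<rightarrow>\<^sub>E UNIV. \<forall>f\<in>{1..a (n + 2)} \<rightarrow>\<^sub>E UNIV.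
        (\<forall>i\<in>{1..?N}. X n i w = x i) \<longrightarrow>
        real_cond_exp M (F n) (?E f) w = (\<Prod>i = 1..?N. K P (\<theta> n w) $ x i $ f i)"
      by (intro AE_finite_allI finite_PiE step_same 1) auto
    then show ?thesis
    proof eventually_elim
      case (elim w)
      let ?x = "restrict (\<lambda>j. X n j w) {1..?N}"
      have x: "?x \<in> {1..?N} \<rightarrow>\<^sub>E UNIV" "\<forall>i\<in>{1..?N}. X n i w = ?x i"
        by auto
      show ?case
      proof (intro exI[of _ ?x] conjI ballI)
        fix f assume f: "f \<in> {1..a (n + 2)} \<rightarrow>\<^sub>E (UNIV :: 'b set)"
        have "real_cond_exp M (F n) (?E f) w = (\<Prod>i = 1..?N. K P (\<theta> n w) $ ?x i $ f i)"
          using elim x f by blast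
        then show "real_cond_exp M (F n) (?E f) w = (\<Prod>j = 1..a (n + 2). K P (\<theta> n w) $ ?x j $ f j)"
          by (simp only: 1)
      qed auto
    qed
  next
    case 2
    have "AE w in M. \<forall>l\<in>{1..?N}. \<forall>x\<in>{1..?N} \<rightarrow>\<^sub>E UNIV. \<forall>f\<in>{1..a (n + 2)} \<rightarrow>\<^sub>E UNIV.
        (\<forall>i\<in>{1..?N}. X n i w = x i) \<and> \<iota> (n + 1) w = l \<longrightarrow>
        real_cond_exp M (F n) (?E f) w
          = (\<Prod>i = 1..?N. K P (\<theta> n w) $ x i $ f i) * K P (\<theta> n w) $ x l $ f (a (n + 2))"
      by (intro AE_finite_allI finite_PiE step_add 2) auto
    then show ?thesis
      using AE_space
    proof eventually_elim
      case (elim w)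
      let ?x = "restrict (\<lambda>j. X n j w) {1..?N}"
      let ?l = "\<iota> (n + 1) w"
      \<comment> \<open>The slot after the last old particle receives the position of the parent
        \<open>?l\<close>.\<close>
      define x' where "x' = ?x(?N + 1 := ?x ?l)"
      have x: "?x \<in> {1..?N} \<rightarrow>\<^sub>E UNIV" "\<forall>i\<in>{1..?N}. X n i w = ?x i"
        by auto
      have l: "?l \<in> {1..?N}"
        by (rule iota_range) (rule elim)
      show ?case
      proof (intro exI[of _ x'] conjI ballI)
        fix f assume f: "f \<in> {1..a (n + 2)} \<rightarrow>\<^sub>E (UNIV :: 'b set)"
        have "real_cond_exp M (F n) (?E f) w
            = (\<Prod>i = 1..?N. K P (\<theta> n w) $ ?x i $ f i) * K P (\<theta> n w) $ ?x ?l $ f (a (n + 2))"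
          using elim(1) l x f by blast
        also have "(\<Prod>i = 1..?N. K P (\<theta> n w) $ ?x i $ f i) = (\<Prod>i = 1..?N. K P (\<theta> n w) $ x' i $ f i)"
          by (intro prod.cong) (auto simp: x'_def)
        also have "?x ?l = x' (?N + 1)"
          by (simp add: x'_def)
        finally show "real_cond_exp M (F n) (?E f) w
            = (\<Prod>j = 1..a (n + 2). K P (\<theta> n w) $ x' j $ f j)"
          unfolding 2 by simp
      qed (auto simp: x'_def)
    qed
  qed
qed

text \<open>Summing the joint law over all configurations with \<open>f i = y\<close> turns the sum
  of products into a product of row sums. The rows of \<open>K\<close> sum to 1, so only the factor
  of particle \<open>i\<close> remains.\<close>

lemma marginal_transition:
  assumes i: "i \<in> {1..a (n + 1)}"
  shows "AE w in M. real_cond_exp M (F n) (indicator {v \<in> space M. X (n + 1) i v = y}) w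
    = K P (\<theta> n w) $ X n i w $ y"
proof -
  interpret F: finite_measure_subalgebra M "F n"
    by (rule F_subalgebra)
  let ?N = "a (n + 2)"
  let ?E = "\<lambda>f. {v \<in> space M. \<forall>i\<in>{1..?N}. X (n + 1) i v = f i}"
  let ?B = "\<lambda>j. if j = i then {y} else UNIV"
  let ?Fs = "{1..?N} \<rightarrow>\<^sub>E (UNIV :: 'b set)"
  let ?Fy = "PiE {1..?N} ?B"
  have iN: "i \<in> {1..?N}"
    using i a_le_Suc[of "n + 1"] by (simp add: numeral_2_eq_2)
  have Xm[measurable]: "X (n + 1) j \<in> measurable M (count_space UNIV)" if "j \<in> {1..?N}" for j
    using X_meas[of j "n + 1"] that by (simp add: numeral_2_eq_2)
  have E_sets[measurable]: "?E f \<in> sets M" for f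
  proof -
    have "?E f = (\<Inter>j\<in>{1..?N}. X (n + 1) j -` {f j} \<inter> space M)"
      using iN by auto
    also have "\<dots> \<in> sets M"
      using iN by (intro sets.finite_INT measurable_sets[OF Xm]) auto
    finally show ?thesis .
  qed
  have E_int: "integrable M (indicator (?E f) :: 'a \<Rightarrow> real)" for f
    by (rule integrable_const_bound[where B = 1, OF _ borel_measurable_indicator[OF E_sets]])
      (simp add: indicator_def)
  have Fy: "?Fy \<subseteq> ?Fs" "finite ?Fy"
    by (auto intro!: finite_PiE PiE_mono)
  have decomp: "(indicator {v \<in> space M. X (n + 1) i v = y} :: 'a \<Rightarrow> real)
      = (\<lambda>v. \<Sum>f\<in>?Fy. indicator (?E f) v)"
  proof
    fix v
    show "indicator {v \<in> space M. X (n + 1) i v = y} v = (\<Sum>f\<in>?Fy. indicator (?E f) v :: real)"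
    proof (cases "v \<in> space M")
      case True
      let ?g = "restrict (\<lambda>j. X (n + 1) j v) {1..?N}"
      have "v \<in> ?E f \<longleftrightarrow> f = ?g" if "f \<in> ?Fy" for f
        using True that by (auto simp: PiE_iff extensional_def fun_eq_iff)
      then have "(\<Sum>f\<in>?Fy. indicator (?E f) v) = (\<Sum>f\<in>?Fy. if f = ?g then 1 else 0 :: real)"
        by (intro sum.cong) (auto simp: indicator_def)
      also have "\<dots> = (if ?g \<in> ?Fy then 1 else 0)"
        using Fy(2) by simp
      also have "?g \<in> ?Fy \<longleftrightarrow> X (n + 1) i v = y"
        using iN by (auto simp: PiE_iff split: if_splits)
      finally show ?thesis
        using True by (simp add: indicator_def)
    qed simp
  qed
  have "AE w in M. real_cond_exp M (F n) (\<lambda>v. \<Sum>f\<in>?Fy. indicator (?E f) v) w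
      = (\<Sum>f\<in>?Fy. real_cond_exp M (F n) (indicator (?E f)) w)"
    by (rule F.real_cond_exp_sum) (rule E_int)
  then show ?thesis
    using joint_transition[of n] AE_space unfolding decomp
  proof eventually_elim
    case (elim w)
    then obtain x where x: "\<forall>j\<in>{1..a (n + 1)}. x j = X n j w"
      and eq: "\<forall>f\<in>?Fs. real_cond_exp M (F n) (indicator (?E f)) w
        = (\<Prod>j = 1..?N. K P (\<theta> n w) $ x j $ f j)"
      by blast
    have "(\<Sum>f\<in>?Fy. real_cond_exp M (F n) (indicator (?E f)) w)
        = (\<Sum>f\<in>?Fy. \<Prod>j = 1..?N. K P (\<theta> n w) $ x j $ f j)"
      using Fy(1) eq by (intro sum.cong) auto
    also have "\<dots> = (\<Prod>j = 1..?N. \<Sum>z\<in>?B j. K P (\<theta> n w) $ x j $ z)"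
      by (rule prod_sum_PiE[symmetric]) auto
    also have "\<dots> = (\<Prod>j = 1..?N. if j = i then K P (\<theta> n w) $ x i $ y else 1)"
      using sum_K_row[OF P_stochastic theta_range[OF elim(3)]] by (intro prod.cong) auto
    also have "\<dots> = K P (\<theta> n w) $ X n i w $ y"
      using iN x i by simp
    finally show ?case
      using elim(1) by simp
  qed
qed

text \<open>The index is that of the conditioning: positions are taken at time \<open>n + 1\<close>,
  averaged as in \<open>theta_step\<close> over \<open>a (n + 1)\<close> particles. A particle added
  at that time is not yet counted.\<close>

definition occupation where
  "occupation n y w = empirical (a (n + 1)) (\<lambda>i. X (n + 1) i w) $ y"

definition innovation where
  "innovation n y w = occupation n y w - real_cond_exp M (F n) (occupation n y) w"

lemma occupation_measurable_F: "occupation n y \<in> borel_measurable (F (Suc n))"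
proof -
  have "(\<lambda>w. (1 / real (a (n + 1))) * (\<Sum>i = 1..a (n + 1). if X (n + 1) i w = y then 1 else 0))
      \<in> borel_measurable (F (Suc n))"
  proof (intro borel_measurable_times borel_measurable_sum borel_measurable_const)
    fix i assume "i \<in> {1..a (n + 1)}"
    then have [measurable]: "X (n + 1) i \<in> measurable (F (Suc n)) (count_space UNIV)"
      using X_measurable_F[of i n] a_le_Suc[of "n + 1"] by (simp add: numeral_2_eq_2)
    show "(\<lambda>w. if X (n + 1) i w = y then 1 else 0 :: real) \<in> borel_measurable (F (Suc n))"
      by measurable
  qed
  then show ?thesis
    unfolding occupation_def empirical_nth .
qed

lemma occupation_measurable [measurable]: "occupation n y \<in> borel_measurable M"
  by (rule measurable_from_subalg[OF F_sub occupation_measurable_F])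

lemma occupation_bounds: "0 \<le> occupation n y w" "occupation n y w \<le> 1"
proof -
  have p: "empirical (a (n + 1)) (\<lambda>i. X (n + 1) i w) \<in> prob_vectors"
    by (rule empirical_prob_vectors[OF a_ge_1])
  then show "0 \<le> occupation n y w"
    by (simp add: occupation_def prob_vectors_def)
  have "occupation n y w \<le> (\<Sum>y\<in>UNIV. empirical (a (n + 1)) (\<lambda>i. X (n + 1) i w) $ y)"
    unfolding occupation_def using p by (intro member_le_sum) (auto simp: prob_vectors_def)
  then show "occupation n y w \<le> 1"
    using p by (simp add: prob_vectors_def)
qed

lemma occupation_integrable: "integrable M (occupation n y)"
  by (rule integrable_const_bound[where B = 1]) (use occupation_bounds in auto)

lemma cond_exp_occupation:
  "AE w in M. real_cond_exp M (F n) (occupation n y) w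
    = killed_step P (empirical (a (n + 1)) (\<lambda>i. X n i w)) $ y
      + (exit_vec P \<bullet> empirical (a (n + 1)) (\<lambda>i. X n i w)) * \<theta> n w $ y"
proof -
  interpret F: finite_measure_subalgebra M "F n"
    by (rule F_subalgebra)
  let ?N = "a (n + 1)"
  \<comment> \<open>Indices out of range get the empty set, since the sum rule for conditional
    expectations asks for integrability at every index.\<close>
  define E where "E i = (if i \<in> {1..?N} then {v \<in> space M. X (n + 1) i v = y} else {})" for i
  have E_sets[measurable]: "E i \<in> sets M" for i
  proof (cases "i \<in> {1..?N}")
    case True
    then have X: "X (n + 1) i \<in> measurable M (count_space UNIV)"
      using X_meas[of i "n + 1"] a_le_Suc[of "n + 1"] by (simp add: numeral_2_eq_2)
    have "E i = X (n + 1) i -` {y} \<inter> space M"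
      using True by (auto simp: E_def)
    then show ?thesis
      using measurable_sets[OF X, of "{y}"] by simp
  next
    case False
    then show ?thesis
      by (simp only: E_def if_False sets.empty_sets)
  qed
  have E_int: "integrable M (indicator (E i) :: 'a \<Rightarrow> real)" for i
    by (rule integrable_const_bound[where B = 1, OF _ borel_measurable_indicator[OF E_sets]])
      (simp add: indicator_def)
  have occ: "occupation n y w = (1 / real ?N) * (\<Sum>i = 1..?N. indicator (E i) w)" if "w \<in> space M" for w
    unfolding occupation_def empirical_nth
    using that by (intro arg_cong2[where f = "(*)"] sum.cong) (auto simp: E_def)
  have "AE w in M. real_cond_exp M (F n) (occupation n y) w
      = real_cond_exp M (F n) (\<lambda>w. (1 / real ?N) * (\<Sum>i = 1..?N. indicator (E i) w)) w"
    using occ by (intro F.real_cond_exp_cong AE_I2) auto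
  moreover have "AE w in M. real_cond_exp M (F n) (\<lambda>w. (1 / real ?N) * (\<Sum>i = 1..?N. indicator (E i) w)) w
      = (1 / real ?N) * real_cond_exp M (F n) (\<lambda>w. \<Sum>i = 1..?N. indicator (E i) w) w"
    by (intro F.real_cond_exp_cmult Bochner_Integration.integrable_sum E_int)
  moreover have "AE w in M. real_cond_exp M (F n) (\<lambda>w. \<Sum>i = 1..?N. indicator (E i) w) w
      = (\<Sum>i = 1..?N. real_cond_exp M (F n) (indicator (E i)) w)"
    by (intro F.real_cond_exp_sum E_int)
  moreover have "AE w in M. \<forall>i\<in>{1..?N}. real_cond_exp M (F n) (indicator (E i)) w
      = K P (\<theta> n w) $ X n i w $ y"
    by (intro AE_finite_allI) (use marginal_transition in \<open>auto simp: E_def\<close>)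
  ultimately show ?thesis
  proof eventually_elim
    case (elim w)
    then show ?case
      by (simp add: empirical_K[symmetric])
  qed
qed

text \<open>An occupation and its conditional expectation both lie between 0 and 1, so the
  differences are bounded by 1 whatever the number of particles; convergence comes from steps of
  order \<open>1 / n\<close>.\<close>

lemma innovation_series_summable:
  "AE w in M. summable (\<lambda>n. step_size gs (Suc n) * innovation n y w)"
proof (rule martingale_difference_series_summable[where F = F and B = 1 and C = gs])
  fix n
  interpret F: finite_measure_subalgebra M "F n"
    by (rule F_subalgebra)
  show "subalgebra M (F n)" "subalgebra (F (Suc n)) (F n)"
    by (rule F_sub subalgebra_F_Suc)+
  have c_meas: "real_cond_exp M (F n) (occupation n y) \<in> borel_measurable (F n)"
    by simp
  show "innovation n y \<in> borel_measurable (F (Suc n))"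
    unfolding innovation_def
    by (intro borel_measurable_diff occupation_measurable_F
        measurable_from_subalg[OF subalgebra_F_Suc c_meas])
  have "AE w in M. 0 \<le> real_cond_exp M (F n) (occupation n y) w"
    by (intro F.real_cond_exp_ge_c occupation_integrable) (simp add: occupation_bounds)
  moreover have "AE w in M. real_cond_exp M (F n) (occupation n y) w \<le> 1"
    by (intro F.real_cond_exp_le_c occupation_integrable) (simp add: occupation_bounds)
  ultimately show "AE w in M. \<bar>innovation n y w\<bar> \<le> 1"
  proof eventually_elim
    case (elim w)
    then show ?case
      using occupation_bounds[of n y w] by (auto simp: innovation_def)
  qed
  have c_int: "integrable M (real_cond_exp M (F n) (occupation n y))"
    by (intro F.real_cond_exp_int occupation_integrable)
  have "AE w in M. real_cond_exp M (F n) (innovation n y) w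
      = real_cond_exp M (F n) (occupation n y) w
        - real_cond_exp M (F n) (real_cond_exp M (F n) (occupation n y)) w"
    unfolding innovation_def by (intro F.real_cond_exp_diff occupation_integrable c_int)
  moreover have "AE w in M. real_cond_exp M (F n) (real_cond_exp M (F n) (occupation n y)) w
      = real_cond_exp M (F n) (occupation n y) w"
    by (intro F.real_cond_exp_F_meas c_int c_meas)
  ultimately show "AE w in M. real_cond_exp M (F n) (innovation n y) w = 0"
    by eventually_elim simp
  show "0 \<le> step_size gs (Suc n)"
    using gs_pos by simp
  show "step_size gs (Suc n) \<le> gs / real (n + 1)"
    using gs_pos by (intro step_size_le) auto
qed

text \<open>
  When a particle is added, the empirical measure over \<open>a (n + 1)\<close> particles at time \<open>n\<close> differs from
  the one over \<open>a n\<close> particles by \<open>O(1 / a n)\<close>; as \<open>a n \<le> n + 1\<close>, the weighted errors are dominated by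
  the telescoping series of \<open>1 / a n - 1 / a (n + 1)\<close>.
\<close>

lemma added_particle_error_summable:
  "summable (\<lambda>n. step_size gs (Suc n)
     * norm (empirical (a (n + 1)) (\<lambda>i. X n i w) - empirical (a n) (\<lambda>i. X n i w)))"
proof (rule summableI_nonneg_bounded)
  define N where "N n = norm (empirical (a (n + 1)) (\<lambda>i. X n i w) - empirical (a n) (\<lambda>i. X n i w))" for n
  have g0: "0 \<le> step_size gs (Suc n)" for n
    using gs_pos by (simp add: N_star_def)
  show "0 \<le> step_size gs (Suc n) * norm (empirical (a (n + 1)) (\<lambda>i. X n i w) - empirical (a n) (\<lambda>i. X n i w))" for n
    using g0 by (intro mult_nonneg_nonneg) auto
  have step: "step_size gs (Suc n) * N n \<le> 2 * gs * (1 / real (a n) - 1 / real (a (Suc n)))" for n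
  proof -
    consider "a (n + 1) = a n" | "a (n + 1) = a n + 1"
      using a_le_Suc[of n] a_Suc_le[of n] by linarith
    then show ?thesis
    proof cases
      case 1
      then show ?thesis by (simp add: N_def)
    next
      case 2
      have a1: "1 \<le> a n"
        by (rule a_ge_1)
      have "step_size gs (Suc n) \<le> gs / real (a n)"
        using gs_pos a1 a_le[of n] by (intro step_size_le) auto
      moreover have "N n \<le> 2 / real (a n + 1)"
        unfolding N_def 2 by (rule norm_empirical_Suc[OF a1])
      ultimately have "step_size gs (Suc n) * N n \<le> gs / real (a n) * (2 / real (a n + 1))"
        using gs_pos by (intro mult_mono) (auto simp: N_def)
      also have "\<dots> = 2 * gs * (1 / real (a n) - 1 / real (a (Suc n)))"
        using 2 a1 by (simp add: field_simps)
      finally show ?thesis .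
    qed
  qed
  fix n
  have "(\<Sum>k<n. step_size gs (Suc k) * N k) \<le> (\<Sum>k<n. 2 * gs * (1 / real (a k) - 1 / real (a (Suc k))))"
    by (intro sum_mono step)
  also have "\<dots> = 2 * gs * (1 / real (a 0) - 1 / real (a n))"
    by (simp only: sum_lessThan_telescope'[of "\<lambda>k. 1 / real (a k)"] flip: sum_distrib_left)
  also have "\<dots> \<le> 2 * gs * 1"
  proof (rule mult_left_mono)
    have "1 / real (a 0) \<le> 1" "0 \<le> 1 / real (a n)"
      using a_ge_1[of 0] by auto
    then show "1 / real (a 0) - 1 / real (a n) \<le> 1"
      by linarith
  qed (use gs_pos in simp)
  finally show "(\<Sum>k<n. step_size gs (Suc k)
      * norm (empirical (a (k + 1)) (\<lambda>i. X k i w) - empirical (a k) (\<lambda>i. X k i w))) \<le> 2 * gs * 1"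
    unfolding N_def .
qed

text \<open>Each coordinate of the residual in the occupation equation is the innovation plus a
  remainder \<open>r\<close>. The remainder arises because the conditional expectation averages over
  \<open>a (n + 1)\<close> particles at time \<open>n\<close>, the equation over \<open>a n\<close>;
  it is linear in the difference \<open>d n\<close>, whose weighted norms are summable.\<close>

lemma occupation_noise_summable:
  "AE w in M. summable (\<lambda>n. step_size gs (Suc n) *\<^sub>R
     (empirical (a (Suc n)) (\<lambda>i. X (Suc n) i w) - killed_step P (empirical (a n) (\<lambda>i. X n i w))
       - (exit_vec P \<bullet> empirical (a n) (\<lambda>i. X n i w)) *\<^sub>R \<theta> n w))"
proof -
  have "AE w in M. \<forall>y\<in>UNIV. summable (\<lambda>n. step_size gs (Suc n) * innovation n y w)"
    by (intro AE_finite_allI innovation_series_summable) simp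
  moreover have "AE w in M. \<forall>y\<in>UNIV. \<forall>n. real_cond_exp M (F n) (occupation n y) w
    = killed_step P (empirical (a (n + 1)) (\<lambda>i. X n i w)) $ y
      + (exit_vec P \<bullet> empirical (a (n + 1)) (\<lambda>i. X n i w)) * \<theta> n w $ y"
    by (intro AE_finite_allI, simp, unfold AE_all_countable) (intro allI cond_exp_occupation)
  ultimately show ?thesis
    using AE_space
  proof eventually_elim
    case (elim w)
    define m where "m n = empirical (a n) (\<lambda>i. X n i w)" for n
    define d where "d n = empirical (a (n + 1)) (\<lambda>i. X n i w) - m n" for n
    obtain B where B: "B > 0" "\<And>x. norm (killed_step P x) \<le> B * norm x"
      using linear_bounded_pos[OF linear_killed_step] by blast
    have "summable (\<lambda>n. step_size gs (Suc n) *
        (m (Suc n) - killed_step P (m n) - (exit_vec P \<bullet> m n) *\<^sub>R \<theta> n w) $ y)" for y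
    proof -
      define r where "r n = killed_step P (d n) $ y + (exit_vec P \<bullet> d n) * \<theta> n w $ y" for n
      have eq: "(m (Suc n) - killed_step P (m n) - (exit_vec P \<bullet> m n) *\<^sub>R \<theta> n w) $ y
          = innovation n y w + r n" for n
      proof -
        have emp: "empirical (a (n + 1)) (\<lambda>i. X n i w) = m n + d n"
          by (simp add: d_def)
        have "real_cond_exp M (F n) (occupation n y) w
          = killed_step P (empirical (a (n + 1)) (\<lambda>i. X n i w)) $ y
            + (exit_vec P \<bullet> empirical (a (n + 1)) (\<lambda>i. X n i w)) * \<theta> n w $ y"
          using elim(2) by blast
        moreover note emp
        moreover have "occupation n y w = m (Suc n) $ y"
          by (simp add: occupation_def m_def)
        ultimately show ?thesis
          by (simp add: innovation_def r_def linear_add[OF linear_killed_step] inner_add_right algebra_simps)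
      qed
      have r_le: "\<bar>r n\<bar> \<le> (B + norm (exit_vec P)) * norm (d n)" for n
      proof -
        have "\<bar>killed_step P (d n) $ y\<bar> \<le> B * norm (d n)"
          using component_le_norm_cart[of "killed_step P (d n)" y] B(2)[of "d n"] by simp
        moreover have "\<bar>(exit_vec P \<bullet> d n) * \<theta> n w $ y\<bar> \<le> norm (exit_vec P) * norm (d n) * 1"
          unfolding abs_mult
          using component_le_norm_cart[of "\<theta> n w" y] prob_vectors_norm_le[OF theta_range[OF elim(3), of n]]
          by (intro mult_mono Cauchy_Schwarz_ineq2) auto
        ultimately show ?thesis
          by (simp add: r_def algebra_simps)
      qed
      have "summable (\<lambda>n. step_size gs (Suc n) * r n)"
      proof (rule summable_comparison_test)
        have "0 \<le> step_size gs (Suc n)" for n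
          using gs_pos by simp
        then have "norm (step_size gs (Suc n) * r n)
            \<le> (B + norm (exit_vec P)) * (step_size gs (Suc n) * norm (d n))" for n
          using mult_left_mono[OF r_le[of n], of "step_size gs (Suc n)"]
          by (simp add: abs_mult mult_ac del: step_size.simps)
        then show "\<exists>N. \<forall>n\<ge>N. norm (step_size gs (Suc n) * r n)
            \<le> (B + norm (exit_vec P)) * (step_size gs (Suc n) * norm (d n))"
          by blast
        show "summable (\<lambda>n. (B + norm (exit_vec P)) * (step_size gs (Suc n) * norm (d n)))"
          unfolding d_def m_def by (intro summable_mult added_particle_error_summable)
      qed
      moreover have "summable (\<lambda>n. step_size gs (Suc n) * innovation n y w)"
        using elim(1) by blast
      ultimately have "summable (\<lambda>n. step_size gs (Suc n) * innovation n y w + step_size gs (Suc n) * r n)"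
        by (rule summable_add[rotated])
      then show ?thesis
        by (simp only: eq distrib_left)
    qed
    then show ?case
      unfolding m_def by (intro summable_vecI) (simp only: vector_scaleR_component real_scaleR_def)
  qed
qed

end

section \<open>Almost sure convergence to the quasi-stationary distribution\<close>

theorem theorem1p3:
  fixes P :: "real ^ ('s::finite option) ^ ('s option)"
    and PP :: "real ^ 's \<Rightarrow> 'v measure"
    and Y :: "nat \<Rightarrow> 'v \<Rightarrow> 's option"
    and \<theta>star :: "real ^ 's"
    and gs \<zeta> :: real
    and M :: "'w measure"
    and x0 :: 's
    and X :: "nat \<Rightarrow> nat \<Rightarrow> 'w \<Rightarrow> 's"
    and \<iota> :: "nat \<Rightarrow> 'w \<Rightarrow> nat"
    and \<theta> :: "nat \<Rightarrow> 'w \<Rightarrow> real ^ 's"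
    and F G H :: "nat \<Rightarrow> 'w measure"
  assumes "absorbed_chain P PP Y"
    and "quasi_stationary PP Y \<theta>star"
    and "gs > 0"
    and "0 < \<zeta>" and "\<zeta> < 1"
    and "algorithm_II M P gs \<zeta> x0 X \<iota> \<theta> F G H"
  shows "AE w in M. (\<lambda>n. \<theta> n w) \<longlonglongrightarrow> \<theta>star"
proof -
  interpret C: absorbed_chain P PP Y
    by fact
  interpret A: algorithm_II M P gs \<zeta> x0 X \<iota> \<theta> F G H "num_particles \<zeta>"
    using assms(6) by simp_all
  interpret S: algorithm_II_stochastic M P gs \<zeta> x0 X \<iota> \<theta> F G H "num_particles \<zeta>"
    by unfold_locales (use C.stochastic assms in auto)
  obtain T v l c where T: "linear T" "\<And>x. T (x - killed_step P x) = x" "\<And>i. 0 < v $ i" "0 < l"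
    "\<And>x. v \<bullet> T x = l * (v \<bullet> x)" "T \<theta>star = l *\<^sub>R \<theta>star" "0 < c" "c \<le> l"
    "\<And>x. v \<bullet> x = 0 \<Longrightarrow> weighted_norm v (T x) \<le> (l - c) * weighted_norm v x"
    using C.green_operator[OF assms(2)] by metis
  let ?g = "\<lambda>n. step_size gs (Suc n)"
  let ?m = "\<lambda>w n. empirical (num_particles \<zeta> n) (\<lambda>i. X n i w)"
  have exit0: "0 \<le> exit_vec P $ i" for i
    by (simp add: exit_vec_def C.P_nonneg)
  have exit1: "exit_vec P $ i \<le> 1" for i
  proof -
    have "0 \<le> (\<Sum>y\<in>UNIV. P $ Some i $ Some y)"
      by (intro sum_nonneg C.P_nonneg)
    then show ?thesis
      by (simp add: exit_vec_def stochastic_matrix_killed_row[OF C.stochastic])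
  qed
  \<comment> \<open>The choice of \<open>N_star\<close> makes every step size less than 1, so the
    coefficients \<open>1 - ?g n\<close> are positive.\<close>
  have gs_less: "gs < real (N_star gs)"
    using assms(3) by (simp add: N_star_def nat_add_distrib) linarith
  have g: "decseq ?g" "?g \<longlonglongrightarrow> 0" "?g n < 1" "\<not> summable ?g" for n
  proof -
    show "decseq ?g"
      using assms(3) gs_less by (auto intro!: decseq_SucI divide_left_mono)
    have eq: "?g = (\<lambda>n. gs * inverse (real (n + N_star gs)))"
      by (auto simp: divide_inverse)
    have "(\<lambda>n. gs * inverse (real n)) \<longlonglongrightarrow> gs * 0"
      by (intro tendsto_mult tendsto_const lim_inverse_n)
    then show "?g \<longlonglongrightarrow> 0"
      unfolding eq using LIMSEQ_ignore_initial_segment[of "\<lambda>n. gs * inverse (real n)" 0 "N_star gs"] by simp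
    show "?g n < 1"
      using assms(3) gs_less by simp
    have "\<not> summable (\<lambda>n. inverse (real (n + N_star gs)))"
      using not_summable_harmonic[where 'a = real] by (subst summable_iff_shift)
    then show "\<not> summable ?g"
      unfolding eq using assms(3) by (subst summable_cmult_iff) simp
  qed
  show ?thesis
    using S.occupation_noise_summable AE_space
  proof eventually_elim
    case (elim w)
    show ?case
    proof (rule occupation_recursion_converges[OF T, where g = ?g and q = "exit_vec P" and m = "?m w"])
      show "\<theta>star \<in> prob_vectors"
        using assms(2) by (simp add: quasi_stationary_def)
      show "\<theta> n w \<in> prob_vectors" for n
        by (rule A.theta_range[OF elim(2)])
      show "?m w n \<in> prob_vectors" for n
        by (rule empirical_prob_vectors[OF S.a_ge_1])
      show "\<theta> (Suc n) w = (1 - ?g n) *\<^sub>R \<theta> n w + ?g n *\<^sub>R ?m w (Suc n)" for n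
        using A.theta_step[OF elim(2), of n] by (simp add: empirical_def del: step_size.simps)
      \<comment> \<open>The noise is defined as the residual, which makes the equation an identity;
        its content is the summability supplied by \<open>elim\<close>.\<close>
      show "?m w (Suc n) = killed_step P (?m w n) + (exit_vec P \<bullet> ?m w n) *\<^sub>R \<theta> n w
          + (?m w (Suc n) - killed_step P (?m w n) - (exit_vec P \<bullet> ?m w n) *\<^sub>R \<theta> n w)" for n
        by simp
    qed (assumption | rule elim g exit0 exit1)+
  qed
qed

end
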